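(* Let $\mathcal{V}$ be a Banach space and $T>0$. The set $\mathcal{G}_2(\mathcal{V})$ of paths on $[0,T]$ which can be enhanced into a geometric $2$-rough path is a linear space when $\dim(\mathcal{V})=1$, and is not a linear space when $\dim(\mathcal{V})\ge2$.
   Context: Let $\triangle_{[0,T]}=\{(s,t):0\le s\le t\le T\}$, and for a Banach space $\mathcal{W}$ let $C(\triangle_{[0,T]},\mathcal{W})$ be the continuous $\alpha:\triangle_{[0,T]}\to\mathcal{W}$ with $\alpha(t,t)=0$ for all $t$. For $p>0$, $\|\alpha\|_{p-var}=(\sup_{D}\sum_{j}\|\alpha(t_j,t_{j+1})\|^p)^{1/p}$, sup over all finite partitions $D=\{t_j\}$ of $[0,T]$; for a continuous path $\gamma$, $\|\gamma\|_{p-var}$ is the $p$-variation of $(s,t)\mapsto\gamma(t)-\gamma(s)$. $C^{1-var}([0,T],\mathcal{V})$ is the set of continuous paths of finite $1$-variation. $\mathcal{V}\otimes\mathcal{V}$ is the completion of the algebraic tensor product in a norm satisfying $\|v\otimes u\|\le\|v\|\|u\|$; $[v_1,v_2]=v_1\otimes v_2-v_2\otimes v_1$; $[\mathcal{V},\mathcal{V}]$ is the closure in $\mathcal V\otimes\mathcal V$ of the span of all $[v_1,v_2]$. For $\gamma\in C^{1-var}([0,T],\mathcal{V})$ the area is $A(\gamma)(s,t)=\frac12\iint_{s<u_1<u_2<t}[d\gamma(u_1),d\gamma(u_2)]$. A pair $(\gamma,\alpha)$ with $\gamma\in C([0,T],\mathcal{V})$, $\alpha\in C(\triangle_{[0,T]},[\mathcal{V},\mathcal{V}])$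 is a geometric $2$-rough path if there exist $\gamma_n\in C^{1-var}([0,T],\mathcal{V})$ with $\left(\|\gamma-\gamma_n\|_{2-var}^2+\|\alpha-A(\gamma_n)\|_{1-var}\right)^{1/2}\to0$. $\mathcal{G}_2(\mathcal{V})$ is the set of continuous paths $\gamma:[0,T]\to\mathcal V$ of vanishing $2$-variation (i.e. $\lim_{\delta\to0}\sup_{|D|\le\delta}\sum_j\|\gamma(t_{j+1})-\gamma(t_j)\|^2=0$, $|D|$ the mesh) for which there exists $\alpha$ such that $(\gamma,\alpha)$ is a geometric $2$-rough path. *)

theory Defs
  imports "HOL-Analysis.Analysis" "HOL-Analysis.Finite_Function_Topology"
begin

section \<open>The algebraic tensor product\<close>

text \<open>The free real vector space on pairs, modulo the span of the bilinearity relations.\<close>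

abbreviation free_gen :: "'a \<Rightarrow> 'b \<Rightarrow> ('a \<times> 'b) \<Rightarrow>\<^sub>0 real" where
  "free_gen v u \<equiv> Poly_Mapping.single (v, u) 1"

definition tensor_relations :: "(('a::real_vector \<times> 'b::real_vector) \<Rightarrow>\<^sub>0 real) set" where
  "tensor_relations = span (
     {free_gen (v + v') u - free_gen v u - free_gen v' u | v v' u. True} \<union>
     {free_gen v (u + u') - free_gen v u - free_gen v u' | v u u'. True} \<union>
     {free_gen (c *\<^sub>R v) u - c *\<^sub>R free_gen v u | c v u. True} \<union>
     {free_gen v (c *\<^sub>R u) - c *\<^sub>R free_gen v u | c v u. True})"

lemma subspace_tensor_relations: "subspace tensor_relations"
  unfolding tensor_relations_def by (rule subspace_span)

definition tensor_eq ::
  "(('a::real_vector \<times> 'b::real_vector) \<Rightarrow>\<^sub>0 real) \<Rightarrow> (('a \<times> 'b) \<Rightarrow>\<^sub>0 real) \<Rightarrow> bool" where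
  "tensor_eq x y \<longleftrightarrow> x - y \<in> tensor_relations"

lemma equivp_tensor_eq: "equivp tensor_eq"
proof (rule equivpI)
  show "reflp tensor_eq"
    by (simp add: reflp_def tensor_eq_def subspace_0[OF subspace_tensor_relations])
  show "symp tensor_eq"
    unfolding symp_def tensor_eq_def
    by (auto dest: subspace_neg[OF subspace_tensor_relations])
  show "transp tensor_eq"
    unfolding transp_def tensor_eq_def
    by (auto dest: subspace_add[OF subspace_tensor_relations])
qed

quotient_type (overloaded) ('a, 'b) tensor =
  "('a::real_vector \<times> 'b::real_vector) \<Rightarrow>\<^sub>0 real" / tensor_eq
  by (rule equivp_tensor_eq)

instantiation tensor :: (real_vector, real_vector) real_vector
begin

lift_definition zero_tensor :: "('a, 'b) tensor" is 0 .

lift_definition plus_tensor :: "('a, 'b) tensor \<Rightarrow> ('a, 'b) tensor \<Rightarrow> ('a, 'b) tensor" is "(+)"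
  unfolding tensor_eq_def
  by (simp only: add_diff_add subspace_add[OF subspace_tensor_relations])

lift_definition uminus_tensor :: "('a, 'b) tensor \<Rightarrow> ('a, 'b) tensor" is uminus
  unfolding tensor_eq_def
  by (simp only: minus_diff_minus subspace_neg[OF subspace_tensor_relations])

lift_definition minus_tensor :: "('a, 'b) tensor \<Rightarrow> ('a, 'b) tensor \<Rightarrow> ('a, 'b) tensor" is "(-)"
  unfolding tensor_eq_def
  by (drule (1) subspace_diff[OF subspace_tensor_relations]) (simp add: algebra_simps)

lift_definition scaleR_tensor :: "real \<Rightarrow> ('a, 'b) tensor \<Rightarrow> ('a, 'b) tensor" is "scaleR"
  unfolding tensor_eq_def
  by (simp only: scaleR_diff_right[symmetric] subspace_scale[OF subspace_tensor_relations])

instance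
  by standard
    (transfer, simp add: algebra_simps tensor_eq_def subspace_0[OF subspace_tensor_relations])+

end

lift_definition tensor :: "'a::real_vector \<Rightarrow> 'b::real_vector \<Rightarrow> ('a, 'b) tensor"
  is free_gen .

lemma bilinear_tensor: "bilinear tensor"
  unfolding bilinear_def
  by (intro conjI allI linearI; transfer; unfold tensor_eq_def tensor_relations_def diff_diff_eq[symmetric];
      rule span_base; blast)


section \<open>Completed tensor products\<close>

definition tensor_norm ::
  "(('a::real_normed_vector, 'b::real_normed_vector) tensor \<Rightarrow> real) \<Rightarrow> bool" where
  "tensor_norm N \<longleftrightarrow>
     (\<forall>x. N x = 0 \<longleftrightarrow> x = 0) \<and>
     (\<forall>x y. N (x + y) \<le> N x + N y) \<and>
     (\<forall>c x. N (c *\<^sub>R x) = \<bar>c\<bar> * N x) \<and>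
     (\<forall>v u. N (tensor v u) \<le> norm v * norm u)"

text \<open>A completion is a Banach space \<open>'w\<close> (completeness is in the type class) with a linear
  isometric embedding of the algebraic tensor product onto a dense subspace.\<close>

definition tensor_completion ::
  "(('a::real_normed_vector, 'b::real_normed_vector) tensor \<Rightarrow> real) \<Rightarrow>
   (('a, 'b) tensor \<Rightarrow> 'w::banach) \<Rightarrow> bool" where
  "tensor_completion N \<iota> \<longleftrightarrow>
     linear \<iota> \<and> (\<forall>x. norm (\<iota> x) = N x) \<and> closure (range \<iota>) = UNIV"

definition bracket ::
  "(('v::real_vector, 'v) tensor \<Rightarrow> 'w::real_vector) \<Rightarrow> 'v \<Rightarrow> 'v \<Rightarrow> 'w" where
  "bracket \<iota> v\<^sub>1 v\<^sub>2 = \<iota> (tensor v\<^sub>1 v\<^sub>2) - \<iota> (tensor v\<^sub>2 v\<^sub>1)"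

definition bracket_space ::
  "(('v::real_vector, 'v) tensor \<Rightarrow> 'w::real_normed_vector) \<Rightarrow> 'w set" where
  "bracket_space \<iota> = closure (span {bracket \<iota> v\<^sub>1 v\<^sub>2 | v\<^sub>1 v\<^sub>2. True})"


section \<open>Partitions and variation\<close>

text \<open>The partition \<open>a = \<tau> 0 < \<tau> 1 < \<dots> < \<tau> n = b\<close>; only \<open>\<tau> 0, \<dots>, \<tau> n\<close> matter.\<close>

definition is_partition :: "real \<Rightarrow> real \<Rightarrow> nat \<Rightarrow> (nat \<Rightarrow> real) \<Rightarrow> bool" where
  "is_partition a b n \<tau> \<longleftrightarrow> \<tau> 0 = a \<and> \<tau> n = b \<and> (\<forall>j<n. \<tau> j < \<tau> (Suc j))"

text \<open>Power with a positive real exponent on \<open>[0, \<infinity>]\<close>.\<close>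

definition epowr :: "ennreal \<Rightarrow> real \<Rightarrow> ennreal" where
  "epowr x p = (if x = \<infinity> then \<infinity> else ennreal (enn2real x powr p))"

definition p_variation :: "real \<Rightarrow> real \<Rightarrow> (real \<times> real \<Rightarrow> 'w::real_normed_vector) \<Rightarrow> ennreal" where
  "p_variation p T \<alpha> =
     epowr (SUP (n, \<tau>) \<in> {(n, \<tau>). is_partition 0 T n \<tau>}.
              ennreal (\<Sum>j<n. norm (\<alpha> (\<tau> j, \<tau> (Suc j))) powr p)) (1 / p)"

definition increments :: "(real \<Rightarrow> 'v::ab_group_add) \<Rightarrow> real \<times> real \<Rightarrow> 'v" where
  "increments \<gamma> = (\<lambda>(s, t). \<gamma> t - \<gamma> s)"

definition vanishing_2_variation :: "real \<Rightarrow> (real \<Rightarrow> 'v::real_normed_vector) \<Rightarrow> bool" where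
  "vanishing_2_variation T \<gamma> \<longleftrightarrow>
     ((\<lambda>\<delta>. SUP (n, \<tau>) \<in> {(n, \<tau>). is_partition 0 T n \<tau> \<and> (\<forall>j<n. \<tau> (Suc j) - \<tau> j \<le> \<delta>)}.
              ennreal (\<Sum>j<n. (norm (\<gamma> (\<tau> (Suc j)) - \<gamma> (\<tau> j)))\<^sup>2)) \<longlongrightarrow> 0) (at_right 0)"


section \<open>Paths and their areas\<close>

text \<open>Paths on \<open>[0, T]\<close> are represented by functions on \<open>real\<close> whose values outside \<open>[0, T]\<close>
  are ignored, and similarly for functions on the triangle.\<close>

definition triangle :: "real \<Rightarrow> (real \<times> real) set" where
  "triangle T = {(s, t). 0 \<le> s \<and> s \<le> t \<and> t \<le> T}"

definition C_triangle :: "real \<Rightarrow> 'w::real_normed_vector set \<Rightarrow> (real \<times> real \<Rightarrow> 'w) set" where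
  "C_triangle T W = {\<alpha>. continuous_on (triangle T) \<alpha> \<and> \<alpha> ` triangle T \<subseteq> W \<and>
                        (\<forall>t\<in>{0..T}. \<alpha> (t, t) = 0)}"

definition C_1var :: "real \<Rightarrow> (real \<Rightarrow> 'v::real_normed_vector) set" where
  "C_1var T = {\<gamma>. continuous_on {0..T} \<gamma> \<and> p_variation 1 T (increments \<gamma>) < \<infinity>}"

text \<open>Riemann--Stieltjes integral of \<open>B (f u) (dg u)\<close> over \<open>[s, t]\<close>, for a bilinear \<open>B\<close>.\<close>

definition has_rs_integral ::
  "('a \<Rightarrow> 'b \<Rightarrow> 'c) \<Rightarrow> (real \<Rightarrow> 'a) \<Rightarrow> (real \<Rightarrow> 'b::real_normed_vector) \<Rightarrow>
   real \<Rightarrow> real \<Rightarrow> 'c::real_normed_vector \<Rightarrow> bool" where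
  "has_rs_integral B f g s t I \<longleftrightarrow>
     (\<forall>e>0. \<exists>d>0. \<forall>n \<tau> \<xi>.
        is_partition s t n \<tau> \<and>
        (\<forall>j<n. \<tau> (Suc j) - \<tau> j < d \<and> \<xi> j \<in> {\<tau> j..\<tau> (Suc j)}) \<longrightarrow>
        norm ((\<Sum>j<n. B (f (\<xi> j)) (g (\<tau> (Suc j)) - g (\<tau> j))) - I) < e)"

definition rs_integral ::
  "('a \<Rightarrow> 'b \<Rightarrow> 'c) \<Rightarrow> (real \<Rightarrow> 'a) \<Rightarrow> (real \<Rightarrow> 'b::real_normed_vector) \<Rightarrow>
   real \<Rightarrow> real \<Rightarrow> 'c::real_normed_vector" where
  "rs_integral B f g s t = (THE I. has_rs_integral B f g s t I)"

text \<open>The double integral over \<open>s < u\<^sub>1 < u\<^sub>2 < t\<close> is taken as an iterated integral, with the inner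
  integral of \<open>1 d\<gamma>(u\<^sub>1)\<close> over \<open>[s, u\<^sub>2]\<close>.\<close>

definition area ::
  "(('v::real_normed_vector, 'v) tensor \<Rightarrow> 'w::real_normed_vector) \<Rightarrow>
   (real \<Rightarrow> 'v) \<Rightarrow> real \<times> real \<Rightarrow> 'w" where
  "area \<iota> \<gamma> = (\<lambda>(s, t). (1 / 2) *\<^sub>R
     rs_integral (bracket \<iota>) (\<lambda>u\<^sub>2. rs_integral scaleR (\<lambda>u\<^sub>1. 1) \<gamma> s u\<^sub>2) \<gamma> s t)"


section \<open>Geometric 2-rough paths\<close>

definition geometric_2_rough_path ::
  "(('v::real_normed_vector, 'v) tensor \<Rightarrow> 'w::real_normed_vector) \<Rightarrow> real \<Rightarrow>
   (real \<Rightarrow> 'v) \<Rightarrow> (real \<times> real \<Rightarrow> 'w) \<Rightarrow> bool" where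
  "geometric_2_rough_path \<iota> T \<gamma> \<alpha> \<longleftrightarrow>
     continuous_on {0..T} \<gamma> \<and> \<alpha> \<in> C_triangle T (bracket_space \<iota>) \<and>
     (\<exists>\<gamma>\<^sub>n :: nat \<Rightarrow> real \<Rightarrow> 'v. (\<forall>n. \<gamma>\<^sub>n n \<in> C_1var T) \<and>
        (\<lambda>n. epowr ((p_variation 2 T (increments (\<lambda>t. \<gamma> t - \<gamma>\<^sub>n n t)))\<^sup>2 +
                    p_variation 1 T (\<lambda>x. \<alpha> x - area \<iota> (\<gamma>\<^sub>n n) x)) (1 / 2))
          \<longlonglongrightarrow> 0)"

definition G2 ::
  "(('v::real_normed_vector, 'v) tensor \<Rightarrow> 'w::real_normed_vector) \<Rightarrow> real \<Rightarrow>
   (real \<Rightarrow> 'v) set" where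
  "G2 \<iota> T = {\<gamma>. continuous_on {0..T} \<gamma> \<and> vanishing_2_variation T \<gamma> \<and>
                (\<exists>\<alpha>. geometric_2_rough_path \<iota> T \<gamma> \<alpha>)}"

text \<open>Being a linear space under the pointwise operations. As values outside \<open>[0, T]\<close> are
  unconstrained in \<open>G2\<close>, this agrees with the same property of the restrictions to \<open>[0, T]\<close>.\<close>

definition linear_space_of_paths :: "(real \<Rightarrow> 'v::real_vector) set \<Rightarrow> bool" where
  "linear_space_of_paths S \<longleftrightarrow>
     (\<lambda>t. 0) \<in> S \<and>
     (\<forall>\<gamma>\<in>S. \<forall>\<eta>\<in>S. (\<lambda>t. \<gamma> t + \<eta> t) \<in> S) \<and>
     (\<forall>c. \<forall>\<gamma>\<in>S. (\<lambda>t. c *\<^sub>R \<gamma> t) \<in> S)"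

text \<open>The library's \<open>dim\<close> is \<open>0\<close> on infinite-dimensional spaces, so these are added separately.\<close>

definition dim_ge_2 :: "'v::real_vector itself \<Rightarrow> bool" where
  "dim_ge_2 _ \<longleftrightarrow>
     2 \<le> dim (UNIV :: 'v set) \<or> \<not> (\<exists>B :: 'v set. finite B \<and> span B = UNIV)"

end

theory Submission
  imports Defs
begin

text \<open>
  If \<open>dim V = 1\<close> all brackets vanish, so every area is \<open>0\<close> and the zero area enhances a path as
  soon as it is a limit of paths of finite 1-variation in the 2-variation.

  If \<open>a\<close> and \<open>b\<close> are independent, take \<open>x(t) = \<Sum>\<^sub>k c\<^sub>k cos (4\<^sup>k t)\<close> and
  \<open>y(t) = \<Sum>\<^sub>k c\<^sub>k sin (4\<^sup>k t)\<close> with \<open>c\<^sub>k = 2\<^sup>-\<^sup>k (k + 1)\<^sup>-\<^sup>1\<^sup>/\<^sup>2\<close>. Since \<open>2\<^sup>k c\<^sub>k\<close> tends to \<open>0\<close>, the tails of these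
  series are 1/2-Hoelder with constants tending to \<open>0\<close>, so the partial sums show that \<open>x a\<close> and \<open>y b\<close>,
  which have zero area, lie in \<open>G2\<close>. If \<open>x a + y b\<close> were in \<open>G2\<close>, Chen's relation along a partition and
  the finite 1-variation of the areas would bound the discrete areas
  \<open>\<Sum>\<^sub>j [\<gamma>(t\<^sub>j) - \<gamma>(0), \<gamma>(t\<^sub>j\<^sub>+\<^sub>1) - \<gamma>(t\<^sub>j)]\<close> uniformly over all uniform partitions. With \<open>4\<^sup>M\<close> pieces,
  orthogonality of characters makes this sum at least \<open>4 \<Sum>\<^sub>k\<^sub><\<^sub>M 4\<^sup>k c\<^sub>k\<^sup>2\<close> times \<open>[a, b]\<close>, and the
  harmonic series diverges.
\<close>

section \<open>The bracket\<close>

text \<open>Only the area obstructs membership of \<open>x a + y b\<close>: as a sum of two paths of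
  vanishing 2-variation this curve has vanishing 2-variation itself. The coefficients must therefore
  meet two competing demands: 2^k c_k tends to 0, for small Hoelder tails, while the sum of 4^k
  c_k^2 diverges, for unbounded area. The factor (k + 1)^(-1/2) makes the latter the harmonic
  series. The enhancement \<alpha> is known only as a limit, so Chen's relation is applied to the
  approximating paths, where the area is an honest integral. A bound uniform in the approximation
  index is then passed to the limit on one fixed partition, which requires only convergence of
  increments. Frequencies in powers of 4 have two uses. Amplitudes near 2^(-k) are then critical for
  exponent 1/2, and on a grid of 4^M points per period all modes k \<ge> M are constant. The
  infinite series thus becomes a trigonometric polynomial whose discrete area is computed exactly,
  with no remainder to estimate.\<close>

lemma lookup_scaleR_poly_mapping [simp]:
  "Poly_Mapping.lookup (c *\<^sub>R x) k = c *\<^sub>R Poly_Mapping.lookup x k"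
proof -
  have "finite {k. c *\<^sub>R Poly_Mapping.lookup x k \<noteq> 0}"
    by (rule finite_subset[OF _ finite_lookup[of x]]) auto
  then show ?thesis
    by (simp add: scaleR_poly_mapping_def Abs_poly_mapping_inverse)
qed

text \<open>The product of two linear functionals is bilinear, so its linear extension to the free
  space kills all four families of relations and descends to the quotient. Such forms serve to tell
  tensors apart.\<close>

lemma tensor_relations_bilinear_form:
  fixes f :: "'a::real_vector \<Rightarrow> real" and g :: "'b::real_vector \<Rightarrow> real"
  assumes "linear f" "linear g" and x: "x \<in> tensor_relations"
  shows "(\<Sum>k\<in>Poly_Mapping.keys x. Poly_Mapping.lookup x k * (f (fst k) * g (snd k))) = 0"
proof -
  interpret f: linear f by fact
  interpret g: linear g by fact
  define \<phi> where "\<phi> k = f (fst k) * g (snd k)" for k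
  define F where "F y = (\<Sum>k\<in>Poly_Mapping.keys y. Poly_Mapping.lookup y k * \<phi> k)" for y
  \<comment> \<open>Cancellation can shrink the set of keys of a sum, so additivity is checked over
    a common finite superset.\<close>
  have F_on: "F y = (\<Sum>k\<in>S. Poly_Mapping.lookup y k * \<phi> k)"
    if "finite S" "Poly_Mapping.keys y \<subseteq> S" for y S
    unfolding F_def using that by (intro sum.mono_neutral_left) (auto simp: in_keys_iff)
  have add: "F (y + z) = F y + F z" for y z
    using F_on[of "Poly_Mapping.keys y \<union> Poly_Mapping.keys z"] Poly_Mapping.keys_add[of y z]
    by (simp add: lookup_add distrib_right sum.distrib)
  have scale: "F (c *\<^sub>R y) = c * F y" for c y
  proof -
    have "Poly_Mapping.keys (c *\<^sub>R y) \<subseteq> Poly_Mapping.keys y"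
      by (auto simp: in_keys_iff)
    then show ?thesis
      using F_on[of "Poly_Mapping.keys y" "c *\<^sub>R y"] F_on[of "Poly_Mapping.keys y" y]
      by (simp add: sum_distrib_left mult.assoc)
  qed
  have lin: "linear F"
    by (rule linearI) (simp_all add: add scale)
  have gen: "F (free_gen v u) = f v * g u" for v u
    by (simp add: F_def \<phi>_def)
  have diff: "F (y - z) = F y - F z" for y z
    by (rule linear_diff[OF lin])
  have "F x = 0"
    using x unfolding tensor_relations_def
    by (rule linear_eq_0_on_span[OF lin, rotated])
      (elim UnE CollectE exE conjE;
       simp only: diff scale gen f.add g.add f.scaleR g.scaleR; simp add: algebra_simps)
  then show ?thesis
    by (simp add: F_def \<phi>_def)
qed

text \<open>With f and g the coordinates along a and b, the form \<open>f v * g u\<close> takes the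
  value 1 at (a, b) and 0 at (b, a).\<close>

lemma tensor_commute_neq:
  fixes a b :: "'v::real_vector"
  assumes "a \<noteq> b" "independent {a, b}"
  shows "tensor a b \<noteq> tensor b a"
proof
  assume "tensor a b = tensor b a"
  then have rel: "free_gen a b - free_gen b a \<in> tensor_relations"
    by (simp add: tensor.abs_eq tensor.abs_eq_iff tensor_eq_def)
  obtain f :: "'v \<Rightarrow> real" where f: "linear f" "f a = 1" "f b = 0"
    using linear_independent_extend[OF assms(2), of "\<lambda>x. if x = a then 1 else 0 :: real"] assms(1)
    by auto
  obtain g :: "'v \<Rightarrow> real" where g: "linear g" "g a = 0" "g b = 1"
    using linear_independent_extend[OF assms(2), of "\<lambda>x. if x = b then 1 else 0 :: real"] assms(1)
    by auto
  have keys: "Poly_Mapping.keys (free_gen a b - free_gen b a) = {(a, b), (b, a)}"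
    using assms(1) by (auto simp: in_keys_iff lookup_minus lookup_single when_def split: if_splits)
  show False
    using tensor_relations_bilinear_form[OF f(1) g(1) rel] assms(1)
    by (simp add: keys lookup_minus lookup_single f g)
qed

text \<open>Definiteness of N and the isometry \<open>\<iota>\<close> carry the algebraic inequality
  into the completion.\<close>

lemma bracket_neq_0:
  fixes \<iota> :: "('v::banach, 'v) tensor \<Rightarrow> 'w::banach"
  assumes "tensor_norm N" "tensor_completion N \<iota>" "a \<noteq> b" "independent {a, b}"
  shows "bracket \<iota> a b \<noteq> 0"
proof -
  have lin: "linear \<iota>" and norm: "norm (\<iota> x) = N x" for x
    using assms(2) by (auto simp: tensor_completion_def)
  have "bracket \<iota> a b = \<iota> (tensor a b - tensor b a)"
    by (simp add: bracket_def linear_diff[OF lin])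
  moreover have "N (tensor a b - tensor b a) \<noteq> 0"
    using assms(1) tensor_commute_neq[OF assms(3,4)] by (auto simp: tensor_norm_def)
  ultimately show ?thesis
    using norm by (metis norm_zero)
qed

lemma bounded_bilinear_bracket:
  fixes \<iota> :: "('v::banach, 'v) tensor \<Rightarrow> 'w::banach"
  assumes "tensor_norm N" "tensor_completion N \<iota>"
  shows "bounded_bilinear (bracket \<iota>)"
proof
  have lin: "linear \<iota>" and norm: "norm (\<iota> x) = N x" for x
    using assms(2) by (auto simp: tensor_completion_def)
  have tensor_lin: "linear (tensor x :: 'v \<Rightarrow> ('v, 'v) tensor)"
    "linear (\<lambda>x. tensor x y :: ('v, 'v) tensor)" for x y :: 'v
    using bilinear_tensor[where 'a='v and 'b='v] by (auto simp: bilinear_def)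
  note simps = linear_add[OF lin] linear_scale[OF lin] linear_add[OF tensor_lin(1)]
    linear_add[OF tensor_lin(2)] linear_scale[OF tensor_lin(1)] linear_scale[OF tensor_lin(2)]
  fix a a' b b' :: 'v and r :: real
  show "bracket \<iota> (a + a') b = bracket \<iota> a b + bracket \<iota> a' b"
    "bracket \<iota> a (b + b') = bracket \<iota> a b + bracket \<iota> a b'"
    "bracket \<iota> (r *\<^sub>R a) b = r *\<^sub>R bracket \<iota> a b"
    "bracket \<iota> a (r *\<^sub>R b) = r *\<^sub>R bracket \<iota> a b"
    by (simp_all add: bracket_def simps algebra_simps)
  have "norm (bracket \<iota> a b) \<le> norm a * norm b * 2" for a b
  proof -
    have le: "N (tensor v u) \<le> norm v * norm u" for v u
      using assms(1) by (auto simp: tensor_norm_def)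
    have "norm (bracket \<iota> a b) \<le> N (tensor a b) + N (tensor b a)"
      unfolding bracket_def norm[symmetric] by (rule norm_triangle_ineq4)
    then show ?thesis
      using le[of a b] le[of b a] by (simp add: mult.commute)
  qed
  then show "\<exists>K. \<forall>a b. norm (bracket \<iota> a b) \<le> norm a * norm b * K"
    by blast
qed

lemma bracket_self [simp]: "bracket \<iota> a a = 0"
  by (simp add: bracket_def)

section \<open>Bases and dimension\<close>

lemma two_independent_vectors:
  assumes "dim_ge_2 TYPE('v::real_vector)"
  obtains a b :: "'v::real_vector" where "a \<noteq> b" "independent {a, b}"
proof -
  obtain B :: "'v set" where B: "independent B" "UNIV \<subseteq> span B" "card B = dim (UNIV :: 'v set)"
    by (rule basis_exists[of "UNIV :: 'v set"])
  \<comment> \<open>A basis with at most one element contradicts both alternatives of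
    \<open>dim_ge_2\<close>: it is finite and spanning, and the dimension is at most 1.\<close>
  have "\<exists>a\<in>B. \<exists>b\<in>B. a \<noteq> b"
  proof (rule ccontr)
    assume "\<not> ?thesis"
    then have "B = {} \<or> (\<exists>a. B = {a})" by blast
    then have "finite B" "card B \<le> 1" by auto
    then show False
      using assms B(2,3) unfolding dim_ge_2_def by auto
  qed
  then obtain a b where "a \<in> B" "b \<in> B" "a \<noteq> b" by blast
  then show ?thesis
    using that independent_mono[OF B(1), of "{a, b}"] by blast
qed

lemma dim_1_multiples:
  assumes "dim (UNIV :: 'v::real_vector set) = 1"
  obtains e :: "'v::real_vector" where "\<And>v. \<exists>c. v = c *\<^sub>R e"
proof -
  obtain B :: "'v set" where B: "UNIV \<subseteq> span B" "card B = 1"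
    using basis_exists[of "UNIV :: 'v set"] assms by metis
  then obtain e where "B = {e}" by (auto simp: card_1_singleton_iff)
  with B(1) show ?thesis
    by (intro that[of e]) (auto simp: span_singleton)
qed

section \<open>Variation\<close>

lemma is_partition_mono:
  assumes "is_partition a b n \<tau>" "i \<le> j" "j \<le> n"
  shows "\<tau> i \<le> \<tau> j"
  using assms(2,3)
proof (induction j rule: dec_induct)
  case (step j)
  then show ?case
    using assms(1) by (fastforce simp: is_partition_def less_eq_Suc_le)
qed simp

lemma is_partition_in:
  assumes "is_partition a b n \<tau>" "j \<le> n"
  shows "\<tau> j \<in> {a..b}"
  using is_partition_mono[OF assms(1), of 0 j] is_partition_mono[OF assms(1), of j n] assms
  by (auto simp: is_partition_def)

lemma is_partition_telescope:
  fixes f :: "real \<Rightarrow> 'a::ab_group_add"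
  assumes "is_partition a b n \<tau>"
  shows "(\<Sum>j<n. f (\<tau> (Suc j)) - f (\<tau> j)) = f b - f a"
  using assms by (simp add: sum_lessThan_telescope[of "\<lambda>j. f (\<tau> j)"] is_partition_def)

lemma is_partition_uniform:
  fixes a b :: real
  assumes "a < b" "n > 0"
  shows "is_partition a b n (\<lambda>j. a + (b - a) * real j / real n)"
  using assms by (auto simp: is_partition_def field_simps)

lemma epowr_1 [simp]: "epowr x 1 = x"
  by (cases x) (auto simp: epowr_def)

lemma epowr_half_square: "(epowr x (1 / 2))\<^sup>2 = x"
  by (cases x) (auto simp: epowr_def ennreal_power powr_half_sqrt)

text \<open>Replaces extended-real suprema by bounds on real sums, one for each partition; the later
  estimates work in this form.\<close>

lemma p_variation_1_le_iff:
  assumes "c \<ge> 0"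
  shows "p_variation 1 T \<alpha> \<le> ennreal c \<longleftrightarrow>
    (\<forall>n \<tau>. is_partition 0 T n \<tau> \<longrightarrow> (\<Sum>j<n. norm (\<alpha> (\<tau> j, \<tau> (Suc j)))) \<le> c)"
  using assms by (auto simp: p_variation_def SUP_le_iff)

lemma p_variation_2_square_le_iff:
  assumes "c \<ge> 0"
  shows "(p_variation 2 T \<alpha>)\<^sup>2 \<le> ennreal c \<longleftrightarrow>
    (\<forall>n \<tau>. is_partition 0 T n \<tau> \<longrightarrow> (\<Sum>j<n. (norm (\<alpha> (\<tau> j, \<tau> (Suc j))))\<^sup>2) \<le> c)"
  using assms by (auto simp: p_variation_def epowr_half_square SUP_le_iff)

text \<open>The weak inequality is deliberate: \<open>SUP \<le> e\<close> unfolds into a bound for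
  every partition, whereas a strict bound on a supremum does not.\<close>

lemma tendsto_0_ennreal_iff:
  fixes f :: "'a \<Rightarrow> ennreal"
  shows "(f \<longlongrightarrow> 0) F \<longleftrightarrow> (\<forall>e>0. \<forall>\<^sub>F x in F. f x \<le> ennreal e)"
proof
  assume f: "(f \<longlongrightarrow> 0) F"
  show "\<forall>e>0. \<forall>\<^sub>F x in F. f x \<le> ennreal e"
  proof (intro allI impI)
    fix e :: real assume "e > 0"
    then have "\<forall>\<^sub>F x in F. f x < ennreal e"
      by (intro order_tendstoD(2)[OF f]) simp
    then show "\<forall>\<^sub>F x in F. f x \<le> ennreal e"
      by eventually_elim simp
  qed
next
  assume f: "\<forall>e>0. \<forall>\<^sub>F x in F. f x \<le> ennreal e"
  show "(f \<longlongrightarrow> 0) F"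
  proof (rule order_tendstoI)
    fix a :: ennreal assume "0 < a"
    then obtain e where e: "e > 0" "ennreal e < a"
      by (metis dense ennreal_cases ennreal_less_zero_iff infinity_ennreal_def
          less_top order_less_trans top_neq_ennreal ennreal_eq_0_iff not_le not_less_zero)
    then have "\<forall>\<^sub>F x in F. f x \<le> ennreal e" using f by blast
    then show "\<forall>\<^sub>F x in F. f x < a"
      by eventually_elim (use e in auto)
  qed simp
qed

text \<open>Removes the outer square root of the rough path distance: a root is at most e exactly
  when the argument, possibly infinite, is at most e^2.\<close>

lemma epowr_half_tendsto_0_iff:
  "((\<lambda>x. epowr (f x) (1 / 2)) \<longlongrightarrow> 0) F \<longleftrightarrow> (f \<longlongrightarrow> 0) F"
proof -
  have le: "epowr y (1 / 2) \<le> ennreal e \<longleftrightarrow> y \<le> ennreal (e\<^sup>2)" if "e > 0" for y e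
  proof (cases y)
    case (real r)
    then show ?thesis
      using that real_sqrt_le_iff[of r "e\<^sup>2"] by (simp add: epowr_def powr_half_sqrt)
  next
    case top
    then show ?thesis by (simp add: epowr_def top_unique)
  qed
  show ?thesis
    unfolding tendsto_0_ennreal_iff
  proof (intro iffI allI impI)
    fix e :: real
    assume "\<forall>e>0. \<forall>\<^sub>F x in F. epowr (f x) (1 / 2) \<le> ennreal e" "e > 0"
    then have "\<forall>\<^sub>F x in F. epowr (f x) (1 / 2) \<le> ennreal (sqrt e)" by simp
    then show "\<forall>\<^sub>F x in F. f x \<le> ennreal e"
      using le[of "sqrt e"] \<open>e > 0\<close> by simp
  next
    fix e :: real
    assume "\<forall>e>0. \<forall>\<^sub>F x in F. f x \<le> ennreal e" "e > 0"
    then show "\<forall>\<^sub>F x in F. epowr (f x) (1 / 2) \<le> ennreal e"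
      using le[of e] by simp
  qed
qed

text \<open>A smaller mesh bound admits fewer partitions, so one good d > 0 is as strong as all d
  near 0.\<close>

lemma vanishing_2_variation_iff:
  "vanishing_2_variation T \<gamma> \<longleftrightarrow>
    (\<forall>e>0. \<exists>d>0. \<forall>n \<tau>. is_partition 0 T n \<tau> \<longrightarrow> (\<forall>j<n. \<tau> (Suc j) - \<tau> j \<le> d) \<longrightarrow>
       (\<Sum>j<n. (norm (\<gamma> (\<tau> (Suc j)) - \<gamma> (\<tau> j)))\<^sup>2) \<le> e)"
  (is "_ \<longleftrightarrow> (\<forall>e>0. \<exists>d>0. ?P e d)")
proof -
  have mono: "?P e d'" if "?P e d" "d' \<le> d" for e d d'
  proof (intro allI impI)
    fix n \<tau> assume "is_partition 0 T n \<tau>" "\<forall>j<n. \<tau> (Suc j) - \<tau> j \<le> d'"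
    moreover from this have "\<forall>j<n. \<tau> (Suc j) - \<tau> j \<le> d"
      using that(2) by force
    ultimately show "(\<Sum>j<n. (norm (\<gamma> (\<tau> (Suc j)) - \<gamma> (\<tau> j)))\<^sup>2) \<le> e"
      using that(1) by blast
  qed
  have "vanishing_2_variation T \<gamma> \<longleftrightarrow> (\<forall>e>0. \<forall>\<^sub>F d in at_right 0. ?P e d)"
    unfolding vanishing_2_variation_def tendsto_0_ennreal_iff
    by (intro all_cong1 imp_cong refl eventually_cong always_eventually) (auto simp: SUP_le_iff)
  also have "\<dots> \<longleftrightarrow> (\<forall>e>0. \<exists>d>0. ?P e d)"
  proof (intro all_cong1 imp_cong refl)
    fix e :: real
    show "(\<forall>\<^sub>F d in at_right 0. ?P e d) \<longleftrightarrow> (\<exists>d>0. ?P e d)"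
    proof
      assume "\<forall>\<^sub>F d in at_right 0. ?P e d"
      then obtain b where b: "b > 0" "\<And>d. 0 < d \<Longrightarrow> d < b \<Longrightarrow> ?P e d"
        unfolding eventually_at_right_field by blast
      \<comment> \<open>The filter speaks only of d strictly below b, hence the half.\<close>
      have "0 < b / 2" "b / 2 < b" using b(1) by auto
      then show "\<exists>d>0. ?P e d"
        using b(2)[of "b / 2"] by blast
    next
      assume "\<exists>d>0. ?P e d"
      then obtain b where b: "b > 0" "?P e b" by blast
      have "?P e d" if "0 < d" "d < b" for d
        by (rule mono[OF b(2)]) (use that in simp)
      with b(1) show "\<forall>\<^sub>F d in at_right 0. ?P e d"
        unfolding eventually_at_right_field by blast
    qed
  qed
  finally show ?thesis .
qed

lemma C_1var_iff:
  "\<gamma> \<in> C_1var T \<longleftrightarrow> continuous_on {0..T} \<gamma> \<and>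
    (\<exists>K\<ge>0. \<forall>n \<tau>. is_partition 0 T n \<tau> \<longrightarrow> (\<Sum>j<n. norm (\<gamma> (\<tau> (Suc j)) - \<gamma> (\<tau> j))) \<le> K)"
proof -
  have "x < \<infinity> \<longleftrightarrow> (\<exists>K\<ge>0. x \<le> ennreal K)" for x :: ennreal
    by (cases x) (auto simp: top_unique)
  then show ?thesis
    by (simp add: C_1var_def p_variation_1_le_iff increments_def cong: conj_cong)
qed

text \<open>A sum of nonnegative terms tends to 0 exactly when both terms do. This separates the
  convergence of the paths from that of the areas.\<close>

lemma geometric_2_rough_path_iff:
  "geometric_2_rough_path \<iota> T \<gamma> \<alpha> \<longleftrightarrow>
     continuous_on {0..T} \<gamma> \<and> \<alpha> \<in> C_triangle T (bracket_space \<iota>) \<and>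
     (\<exists>\<gamma>\<^sub>n. (\<forall>m. \<gamma>\<^sub>n m \<in> C_1var T) \<and>
       (\<forall>e>0. \<forall>\<^sub>F m in sequentially. \<forall>n \<tau>. is_partition 0 T n \<tau> \<longrightarrow>
          (\<Sum>j<n. (norm ((\<gamma> (\<tau> (Suc j)) - \<gamma>\<^sub>n m (\<tau> (Suc j))) - (\<gamma> (\<tau> j) - \<gamma>\<^sub>n m (\<tau> j))))\<^sup>2) \<le> e) \<and>
       (\<forall>e>0. \<forall>\<^sub>F m in sequentially. \<forall>n \<tau>. is_partition 0 T n \<tau> \<longrightarrow>
          (\<Sum>j<n. norm (\<alpha> (\<tau> j, \<tau> (Suc j)) - area \<iota> (\<gamma>\<^sub>n m) (\<tau> j, \<tau> (Suc j)))) \<le> e))"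
proof -
  have sum: "((\<lambda>x. f x + g x) \<longlongrightarrow> 0) F \<longleftrightarrow> (f \<longlongrightarrow> 0) F \<and> (g \<longlongrightarrow> 0) F"
    for f g :: "nat \<Rightarrow> ennreal" and F
  proof
    assume *: "((\<lambda>x. f x + g x) \<longlongrightarrow> 0) F"
    show "(f \<longlongrightarrow> 0) F \<and> (g \<longlongrightarrow> 0) F"
      by (intro conjI; rule tendsto_sandwich[OF _ _ tendsto_const *]) auto
  next
    assume "(f \<longlongrightarrow> 0) F \<and> (g \<longlongrightarrow> 0) F"
    then show "((\<lambda>x. f x + g x) \<longlongrightarrow> 0) F"
      using tendsto_add[of f 0 F g 0] by simp
  qed
  show ?thesis
    unfolding geometric_2_rough_path_def epowr_half_tendsto_0_iff sum tendsto_0_ennreal_iff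
    by (simp add: p_variation_1_le_iff p_variation_2_square_le_iff increments_def)
qed

section \<open>Riemann--Stieltjes integrals\<close>

lemma uniform_partition_step:
  fixes a b :: real
  assumes "n > 0"
  shows "a + (b - a) * real (Suc j) / real n - (a + (b - a) * real j / real n) = (b - a) / real n"
  using assms by (simp add: field_simps)

lemma is_partition_snoc:
  assumes "is_partition a s n \<tau>" "s < t"
  shows "is_partition a t (Suc n) (\<tau>(Suc n := t))"
  using assms by (auto simp: is_partition_def less_Suc_eq)

text \<open>Here \<open>v t\<close> is the length of the path on [0, t]; appending t to a partition
  of [0, s] shows that it grows by at least the increment. Bounds by increments of a scalar function
  have the advantage that they telescope.\<close>

lemma C_1var_control:
  assumes "\<gamma> \<in> C_1var T"
  obtains v where "\<And>s t. 0 \<le> s \<Longrightarrow> s \<le> t \<Longrightarrow> t \<le> T \<Longrightarrow> norm (\<gamma> t - \<gamma> s) \<le> v t - v s"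
proof -
  define X where "X t = {\<Sum>j<n. norm (\<gamma> (\<tau> (Suc j)) - \<gamma> (\<tau> j)) | n \<tau>. is_partition 0 t n \<tau>}" for t
  obtain K where K: "\<And>n \<tau>. is_partition 0 T n \<tau> \<Longrightarrow> (\<Sum>j<n. norm (\<gamma> (\<tau> (Suc j)) - \<gamma> (\<tau> j))) \<le> K"
    using assms unfolding C_1var_iff by blast
  have ext: "x + norm (\<gamma> t - \<gamma> s) \<in> X t" if x: "x \<in> X s" and "s < t" for x s t
  proof -
    obtain n \<tau> where \<tau>: "is_partition 0 s n \<tau>" "x = (\<Sum>j<n. norm (\<gamma> (\<tau> (Suc j)) - \<gamma> (\<tau> j)))"
      using x by (auto simp: X_def)
    let ?\<sigma> = "\<tau>(Suc n := t)"
    have "x + norm (\<gamma> t - \<gamma> s) = (\<Sum>j<Suc n. norm (\<gamma> (?\<sigma> (Suc j)) - \<gamma> (?\<sigma> j)))"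
      using \<tau> by (auto simp: is_partition_def intro!: sum.cong)
    then show ?thesis
      using is_partition_snoc[OF \<tau>(1) that(2)] unfolding X_def by blast
  qed
  have upper: "x \<le> K" if "x \<in> X t" "t \<le> T" for x t
  proof (cases "t = T")
    case True
    then show ?thesis using that K by (auto simp: X_def)
  next
    case False
    \<comment> \<open>The bound K concerns partitions of all of [0, T], so a partition of [0, t] is
      first prolonged by the point T.\<close>
    then have "x + norm (\<gamma> T - \<gamma> t) \<in> X T" using that ext by auto
    then have "x + norm (\<gamma> T - \<gamma> t) \<le> K" using K by (auto simp: X_def)
    then show ?thesis by (smt (verit) norm_ge_zero)
  qed
  \<comment> \<open>The partition of [0, 0] with no pieces yields the empty sum; it keeps the
    suprema from ranging over empty sets.\<close>
  have "0 \<in> X 0"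
    unfolding X_def is_partition_def by (intro CollectI exI[of _ 0] exI[of _ "\<lambda>_. 0"]) simp
  then have nonempty: "X t \<noteq> {}" if "t \<ge> 0" for t
    using that ext[of 0 0 t] by (cases "t = 0") auto
  show ?thesis
  proof (rule that[of "\<lambda>t. Sup (X t)"])
    fix s t assume st: "0 \<le> s" "s \<le> t" "t \<le> T"
    show "norm (\<gamma> t - \<gamma> s) \<le> Sup (X t) - Sup (X s)"
    proof (cases "s = t")
      case False
      have "Sup (X s) \<le> Sup (X t) - norm (\<gamma> t - \<gamma> s)"
      proof (rule cSup_least[OF nonempty[OF st(1)]])
        fix x assume "x \<in> X s"
        then have "x + norm (\<gamma> t - \<gamma> s) \<le> Sup (X t)"
          using False st ext upper by (intro cSup_upper bdd_aboveI[of _ K]) auto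
        then show "x \<le> Sup (X t) - norm (\<gamma> t - \<gamma> s)" by simp
      qed
      then show ?thesis by simp
    qed simp
  qed
qed

lemma fine_partition_exists:
  fixes a b :: real
  assumes "a \<le> b" "d > 0"
  obtains n \<tau> where "is_partition a b n \<tau>" "\<And>j. j < n \<Longrightarrow> \<tau> (Suc j) - \<tau> j < d"
proof (cases "a = b")
  case True
  then show ?thesis
    by (intro that[of 0 "\<lambda>_. a"]) (auto simp: is_partition_def)
next
  case False
  obtain n where n: "(b - a) / d < real n"
    using reals_Archimedean2 by blast
  have "0 < (b - a) / d" using False assms by simp
  with n have "n > 0" by (cases n) auto
  with n have "(b - a) / n < d" using assms(2) by (simp add: field_simps)
  with \<open>n > 0\<close> show ?thesis
    using is_partition_uniform[of a b n] False assms(1) uniform_partition_step[of n a b] that by force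
qed

text \<open>One partition fine enough for both integrals compares them through the same sum.
  Uniqueness is what gives the \<open>THE\<close> in \<open>rs_integral\<close> its meaning.\<close>

lemma has_rs_integral_unique:
  assumes "a \<le> b" "has_rs_integral B f g a b I" "has_rs_integral B f g a b J"
  shows "I = J"
proof (rule ccontr)
  assume "I \<noteq> J"
  define e where "e = norm (I - J) / 2"
  have "e > 0" using \<open>I \<noteq> J\<close> by (simp add: e_def)
  let ?S = "\<lambda>n \<tau>. \<Sum>j<n. B (f (\<tau> j)) (g (\<tau> (Suc j)) - g (\<tau> j))"
  obtain d where d: "d > 0" "\<And>n \<tau> \<xi>. is_partition a b n \<tau> \<Longrightarrow>
      (\<forall>j<n. \<tau> (Suc j) - \<tau> j < d \<and> \<xi> j \<in> {\<tau> j..\<tau> (Suc j)}) \<Longrightarrow>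
      norm ((\<Sum>j<n. B (f (\<xi> j)) (g (\<tau> (Suc j)) - g (\<tau> j))) - I) < e"
    using assms(2) \<open>e > 0\<close> unfolding has_rs_integral_def by meson
  obtain d' where d': "d' > 0" "\<And>n \<tau> \<xi>. is_partition a b n \<tau> \<Longrightarrow>
      (\<forall>j<n. \<tau> (Suc j) - \<tau> j < d' \<and> \<xi> j \<in> {\<tau> j..\<tau> (Suc j)}) \<Longrightarrow>
      norm ((\<Sum>j<n. B (f (\<xi> j)) (g (\<tau> (Suc j)) - g (\<tau> j))) - J) < e"
    using assms(3) \<open>e > 0\<close> unfolding has_rs_integral_def by meson
  obtain n \<tau> where \<tau>: "is_partition a b n \<tau>" "\<And>j. j < n \<Longrightarrow> \<tau> (Suc j) - \<tau> j < min d d'"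
    using fine_partition_exists[of a b "min d d'"] assms(1) d(1) d'(1) by auto
  have "\<tau> j \<le> \<tau> (Suc j)" if "j < n" for j
    using \<tau>(1) that by (simp add: is_partition_def less_imp_le)
  then have "norm (?S n \<tau> - I) < e" "norm (?S n \<tau> - J) < e"
    using \<tau> by (auto intro!: d(2) d'(2))
  moreover have "norm (I - J) \<le> norm (?S n \<tau> - I) + norm (?S n \<tau> - J)"
    using norm_triangle_ineq4[of "?S n \<tau> - J" "?S n \<tau> - I"] by simp
  ultimately show False by (simp add: e_def)
qed

lemma rs_integral_eq:
  assumes "a \<le> b" "has_rs_integral B f g a b I"
  shows "rs_integral B f g a b = I"
  unfolding rs_integral_def
  by (rule the_equality) (use assms has_rs_integral_unique[OF assms(1)] in auto)

text \<open>All tags lie in [a, b]. This allows the inner integral of \<open>area\<close> to be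
  replaced by an increment of the path, an identity available only for upper limits not below
  s.\<close>

lemma has_rs_integral_cong:
  assumes f: "\<And>x. x \<in> {a..b} \<Longrightarrow> f x = f' x" and I: "has_rs_integral B f' g a b I"
  shows "has_rs_integral B f g a b I"
  unfolding has_rs_integral_def
proof (intro allI impI)
  fix e :: real assume "e > 0"
  then obtain d where d: "d > 0" "\<And>n \<tau> \<xi>. is_partition a b n \<tau> \<Longrightarrow>
      (\<forall>j<n. \<tau> (Suc j) - \<tau> j < d \<and> \<xi> j \<in> {\<tau> j..\<tau> (Suc j)}) \<Longrightarrow>
      norm ((\<Sum>j<n. B (f' (\<xi> j)) (g (\<tau> (Suc j)) - g (\<tau> j))) - I) < e"
    using I unfolding has_rs_integral_def by meson
  have "norm ((\<Sum>j<n. B (f (\<xi> j)) (g (\<tau> (Suc j)) - g (\<tau> j))) - I) < e"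
    if \<tau>: "is_partition a b n \<tau>" "\<forall>j<n. \<tau> (Suc j) - \<tau> j < d \<and> \<xi> j \<in> {\<tau> j..\<tau> (Suc j)}" for n \<tau> \<xi>
  proof -
    have "(\<Sum>j<n. B (f (\<xi> j)) (g (\<tau> (Suc j)) - g (\<tau> j))) =
        (\<Sum>j<n. B (f' (\<xi> j)) (g (\<tau> (Suc j)) - g (\<tau> j)))"
    proof (intro sum.cong refl arg_cong2[where f=B] f)
      fix j assume "j \<in> {..<n}"
      then show "\<xi> j \<in> {a..b}"
        using \<tau>(2) is_partition_in[OF \<tau>(1), of j] is_partition_in[OF \<tau>(1), of "Suc j"]
        by force
    qed
    then show ?thesis using d(2)[OF \<tau>] by simp
  qed
  with d(1) show "\<exists>d>0. \<forall>n \<tau> \<xi>. is_partition a b n \<tau> \<and>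
      (\<forall>j<n. \<tau> (Suc j) - \<tau> j < d \<and> \<xi> j \<in> {\<tau> j..\<tau> (Suc j)}) \<longrightarrow>
      norm ((\<Sum>j<n. B (f (\<xi> j)) (g (\<tau> (Suc j)) - g (\<tau> j))) - I) < e"
    by blast
qed

lemma rs_integral_one:
  assumes "a \<le> b"
  shows "rs_integral scaleR (\<lambda>_. 1) g a b = g b - g a"
  using assms by (intro rs_integral_eq)
    (auto simp: has_rs_integral_def is_partition_telescope intro: exI[of _ 1])

text \<open>The interval \<open>[\<tau> i, \<tau> (Suc i)] \<inter> [\<sigma> j, \<sigma> (Suc j)]\<close> of the common refinement is described by
  clamping the points of one partition to an interval of the other; clamping either way gives the
  same increments, so both Riemann sums become double sums over the same increments.\<close>

lemma rs_sums_close: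
  fixes g :: "real \<Rightarrow> 'b::real_normed_vector" and B :: "'a::real_normed_vector \<Rightarrow> 'b \<Rightarrow> 'c::real_normed_vector"
  assumes B: "bounded_bilinear B" and K: "K \<ge> 0" "\<And>x y. norm (B x y) \<le> norm x * norm y * K"
    and v: "\<And>s t. a \<le> s \<Longrightarrow> s \<le> t \<Longrightarrow> t \<le> b \<Longrightarrow> norm (g t - g s) \<le> v t - v s"
    and f: "\<And>x y. x \<in> {a..b} \<Longrightarrow> y \<in> {a..b} \<Longrightarrow> \<bar>x - y\<bar> < 2 * d \<Longrightarrow> norm (f x - f y) \<le> e"
    and e: "e \<ge> 0"
    and \<tau>: "is_partition a b n \<tau>" "\<forall>i<n. \<tau> (Suc i) - \<tau> i < d \<and> \<xi> i \<in> {\<tau> i..\<tau> (Suc i)}"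
    and \<sigma>: "is_partition a b m \<sigma>" "\<forall>j<m. \<sigma> (Suc j) - \<sigma> j < d \<and> \<eta> j \<in> {\<sigma> j..\<sigma> (Suc j)}"
  shows "norm ((\<Sum>i<n. B (f (\<xi> i)) (g (\<tau> (Suc i)) - g (\<tau> i))) -
               (\<Sum>j<m. B (f (\<eta> j)) (g (\<sigma> (Suc j)) - g (\<sigma> j)))) \<le> e * K * (v b - v a)"
proof -
  interpret bounded_bilinear B by fact
  have \<tau>_in: "\<tau> i \<in> {a..b}" if "i \<le> n" for i
    using is_partition_in[OF \<tau>(1) that] .
  have \<sigma>_in: "\<sigma> j \<in> {a..b}" if "j \<le> m" for j
    using is_partition_in[OF \<sigma>(1) that] .
  have \<tau>_less: "\<tau> i < \<tau> (Suc i)" if "i < n" for i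
    using \<tau>(1) that by (simp add: is_partition_def)
  have \<sigma>_less: "\<sigma> j < \<sigma> (Suc j)" if "j < m" for j
    using \<sigma>(1) that by (simp add: is_partition_def)
  have ends: "\<tau> 0 = a" "\<tau> n = b" "\<sigma> 0 = a" "\<sigma> m = b"
    using \<tau>(1) \<sigma>(1) by (auto simp: is_partition_def)
  define c where "c i x = max (\<tau> i) (min (\<tau> (Suc i)) x)" for i x
  define c' where "c' j x = max (\<sigma> j) (min (\<sigma> (Suc j)) x)" for j x
  define \<Delta> where "\<Delta> i j = g (c i (\<sigma> (Suc j))) - g (c i (\<sigma> j))" for i j
  have \<Delta>': "\<Delta> i j = g (c' j (\<tau> (Suc i))) - g (c' j (\<tau> i))" if "i < n" "j < m" for i j
    using \<tau>_less[OF that(1)] \<sigma>_less[OF that(2)]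
    by (auto simp: \<Delta>_def c_def c'_def max_def min_def)
  have tele: "(\<Sum>j<m. h (c i (\<sigma> (Suc j))) - h (c i (\<sigma> j))) = h (\<tau> (Suc i)) - h (\<tau> i)"
    if "i < n" for i and h :: "real \<Rightarrow> 'x::ab_group_add"
  proof -
    have "c i a = \<tau> i" "c i b = \<tau> (Suc i)"
      using \<tau>_in[of i] \<tau>_in[of "Suc i"] that \<tau>_less[OF that] by (auto simp: c_def max_def min_def)
    then show ?thesis
      using sum_lessThan_telescope[of "\<lambda>j. h (c i (\<sigma> j))" m] ends by simp
  qed
  have tele': "(\<Sum>i<n. h (c' j (\<tau> (Suc i))) - h (c' j (\<tau> i))) = h (\<sigma> (Suc j)) - h (\<sigma> j)"
    if "j < m" for j and h :: "real \<Rightarrow> 'x::ab_group_add"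
  proof -
    have "c' j a = \<sigma> j" "c' j b = \<sigma> (Suc j)"
      using \<sigma>_in[of j] \<sigma>_in[of "Suc j"] that \<sigma>_less[OF that] by (auto simp: c'_def max_def min_def)
    then show ?thesis
      using sum_lessThan_telescope[of "\<lambda>i. h (c' j (\<tau> i))" n] ends by simp
  qed
  have "(\<Sum>i<n. B (f (\<xi> i)) (g (\<tau> (Suc i)) - g (\<tau> i))) = (\<Sum>i<n. \<Sum>j<m. B (f (\<xi> i)) (\<Delta> i j))"
    by (intro sum.cong refl) (simp add: \<Delta>_def tele flip: sum_right)
  moreover have "(\<Sum>j<m. B (f (\<eta> j)) (g (\<sigma> (Suc j)) - g (\<sigma> j))) = (\<Sum>j<m. \<Sum>i<n. B (f (\<eta> j)) (\<Delta> i j))"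
    by (intro sum.cong refl) (simp add: \<Delta>' tele' flip: sum_right)
  ultimately have "(\<Sum>i<n. B (f (\<xi> i)) (g (\<tau> (Suc i)) - g (\<tau> i))) -
      (\<Sum>j<m. B (f (\<eta> j)) (g (\<sigma> (Suc j)) - g (\<sigma> j))) =
      (\<Sum>i<n. \<Sum>j<m. B (f (\<xi> i) - f (\<eta> j)) (\<Delta> i j))"
    using sum.swap[of "\<lambda>j i. B (f (\<eta> j)) (\<Delta> i j)" "{..<n}" "{..<m}"]
    by (simp add: diff_left sum_subtractf)
  also have "norm \<dots> \<le> (\<Sum>i<n. \<Sum>j<m. e * K * (v (c i (\<sigma> (Suc j))) - v (c i (\<sigma> j))))"
  proof (intro order_trans[OF norm_sum] sum_mono)
    fix i j assume ij: "i \<in> {..<n}" "j \<in> {..<m}"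
    let ?l = "c i (\<sigma> j)" and ?r = "c i (\<sigma> (Suc j))"
    have lr: "a \<le> ?l" "?l \<le> ?r" "?r \<le> b"
      using ij \<tau>_in[of i] \<tau>_in[of "Suc i"] \<sigma>_less[of j] by (auto simp: c_def max_def min_def)
    show "norm (B (f (\<xi> i) - f (\<eta> j)) (\<Delta> i j)) \<le> e * K * (v ?r - v ?l)"
    \<comment> \<open>If the two cells do not overlap, their tags may be far apart, but the clamped
      increment is 0. If they overlap, each being shorter than d, the tags differ by less than 2
      d.\<close>
    proof (cases "?l = ?r")
      case True
      then show ?thesis by (simp add: \<Delta>_def zero_right)
    next
      case False
      then have "\<sigma> j < \<tau> (Suc i)" "\<tau> i < \<sigma> (Suc j)"
        using ij \<sigma>_less[of j] \<tau>_less[of i] by (auto simp: c_def max_def min_def split: if_splits)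
      moreover have "\<tau> (Suc i) - \<tau> i < d" "\<sigma> (Suc j) - \<sigma> j < d"
        "\<xi> i \<in> {\<tau> i..\<tau> (Suc i)}" "\<eta> j \<in> {\<sigma> j..\<sigma> (Suc j)}"
        using ij \<tau>(2) \<sigma>(2) by auto
      ultimately have "\<bar>\<xi> i - \<eta> j\<bar> < 2 * d" "\<xi> i \<in> {a..b}" "\<eta> j \<in> {a..b}"
        using ij \<tau>_in[of i] \<tau>_in[of "Suc i"] \<sigma>_in[of j] \<sigma>_in[of "Suc j"] by auto
      then have "norm (f (\<xi> i) - f (\<eta> j)) * norm (\<Delta> i j) * K \<le> e * (v ?r - v ?l) * K"
        using K(1) e lr unfolding \<Delta>_def by (intro mult_mono mult_right_mono f v) auto
      then show ?thesis
        using K(2)[of "f (\<xi> i) - f (\<eta> j)" "\<Delta> i j"] by (simp add: mult_ac)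
    qed
  qed
  also have "\<dots> = e * K * (v b - v a)"
    using is_partition_telescope[OF \<tau>(1), of v] by (simp add: tele flip: sum_distrib_left)
  finally show ?thesis .
qed

text \<open>Cauchy's criterion: a continuous integrand is uniformly continuous on [a, b], so
  \<open>rs_sums_close\<close> makes any two sufficiently fine sums close, and completeness supplies
  the limit.\<close>

lemma has_rs_integral_exists:
  fixes g :: "real \<Rightarrow> 'b::real_normed_vector" and B :: "'a::real_normed_vector \<Rightarrow> 'b \<Rightarrow> 'c::banach"
  assumes B: "bounded_bilinear B" and ab: "a < b" and f: "continuous_on {a..b} f"
    and v: "\<And>s t. a \<le> s \<Longrightarrow> s \<le> t \<Longrightarrow> t \<le> b \<Longrightarrow> norm (g t - g s) \<le> v t - v s"
  obtains I where "has_rs_integral B f g a b I"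
proof -
  obtain K where K: "K > 0" "\<And>x y. norm (B x y) \<le> norm x * norm y * K"
    using bounded_bilinear.pos_bounded[OF B] by blast
  \<comment> \<open>Adding 1 keeps the divisor in \<open>e'\<close> positive even when v has no
    growth.\<close>
  define V where "V = v b - v a + 1"
  have "norm (g b - g a) \<le> v b - v a" using v[of a b] ab by simp
  then have "0 \<le> v b - v a" by (rule order_trans[OF norm_ge_zero])
  then have V: "V > 0" "v b - v a \<le> V" by (auto simp: V_def)
  define tagged_fine where "tagged_fine d n \<tau> \<xi> \<longleftrightarrow> is_partition a b n \<tau> \<and>
    (\<forall>j<n. \<tau> (Suc j) - \<tau> j < d \<and> \<xi> j \<in> {\<tau> j..\<tau> (Suc j)})" for d n and \<tau> \<xi> :: "nat \<Rightarrow> real"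
  define S where "S n \<tau> \<xi> = (\<Sum>j<n. B (f (\<xi> j)) (g (\<tau> (Suc j)) - g (\<tau> j)))" for n \<tau> \<xi>
  have close: "\<exists>d>0. \<forall>n \<tau> \<xi> m \<sigma> \<eta>. tagged_fine d n \<tau> \<xi> \<longrightarrow> tagged_fine d m \<sigma> \<eta> \<longrightarrow>
      norm (S n \<tau> \<xi> - S m \<sigma> \<eta>) \<le> e" if "e > 0" for e
  proof -
    define e' where "e' = e / (K * V)"
    have "e' > 0" using that K V by (simp add: e'_def)
    have "uniformly_continuous_on {a..b} f"
      by (rule compact_uniformly_continuous[OF f]) simp
    then obtain d where d: "d > 0"
      "\<And>x y. x \<in> {a..b} \<Longrightarrow> y \<in> {a..b} \<Longrightarrow> dist x y < d \<Longrightarrow> dist (f x) (f y) < e'"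
      unfolding uniformly_continuous_on_def using \<open>e' > 0\<close> by metis
    \<comment> \<open>Mesh d / 2, because tags of overlapping cells may be nearly twice the mesh
      apart.\<close>
    have "norm (S n \<tau> \<xi> - S m \<sigma> \<eta>) \<le> e"
      if "tagged_fine (d / 2) n \<tau> \<xi>" "tagged_fine (d / 2) m \<sigma> \<eta>" for n \<tau> \<xi> m \<sigma> \<eta>
    proof -
      have "norm (S n \<tau> \<xi> - S m \<sigma> \<eta>) \<le> e' * K * (v b - v a)"
        unfolding S_def
      proof (rule rs_sums_close[OF B, where d="d / 2" and f=f and g=g and v=v and e=e' and K=K])
        show "norm (f x - f y) \<le> e'" if "x \<in> {a..b}" "y \<in> {a..b}" "\<bar>x - y\<bar> < 2 * (d / 2)" for x y
          using d(2)[OF that(1,2)] that(3) by (simp add: dist_norm)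
      qed (use that K \<open>e' > 0\<close> v in \<open>auto simp: tagged_fine_def\<close>)
      also have "\<dots> \<le> e' * K * V"
        using V(2) \<open>e' > 0\<close> K(1) by (intro mult_left_mono) auto
      also have "\<dots> = e" using K(1) V(1) by (simp add: e'_def)
      finally show ?thesis .
    qed
    with d(1) show ?thesis by (intro exI[of _ "d / 2"]) auto
  qed
  \<comment> \<open>One particular sequence of ever finer sums names the limit; all other fine sums
    are then compared with it. Using \<open>Suc q\<close> pieces avoids a division by zero.\<close>
  define s where "s q = (let u = (\<lambda>j. a + (b - a) * real j / real (Suc q)) in S (Suc q) u u)" for q
  have s_fine: "\<forall>\<^sub>F q in sequentially. \<exists>n \<tau> \<xi>. tagged_fine d n \<tau> \<xi> \<and> s q = S n \<tau> \<xi>" if "d > 0" for d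
  proof -
    have "(\<lambda>q. (b - a) * inverse (real (Suc q))) \<longlonglongrightarrow> (b - a) * 0"
      by (intro tendsto_intros LIMSEQ_inverse_real_of_nat)
    then have "\<forall>\<^sub>F q in sequentially. (b - a) * inverse (real (Suc q)) < d"
      using order_tendstoD(2) that by fastforce
    then show ?thesis
    proof eventually_elim
      case (elim q)
      let ?u = "\<lambda>j. a + (b - a) * real j / real (Suc q)"
      have "?u (Suc j) - ?u j = (b - a) * inverse (real (Suc q))" for j
        using uniform_partition_step[of "Suc q" a b j] by (simp add: divide_inverse)
      then have "tagged_fine d (Suc q) ?u ?u"
        using elim ab is_partition_uniform[OF ab, of "Suc q"]
        unfolding tagged_fine_def by (auto simp: divide_right_mono mult_left_mono)
      then show ?case unfolding s_def Let_def by blast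
    qed
  qed
  have "Cauchy s"
  proof (rule CauchyI)
    fix e :: real assume "e > 0"
    then obtain d where d: "d > 0" "\<And>n \<tau> \<xi> m \<sigma> \<eta>. tagged_fine d n \<tau> \<xi> \<Longrightarrow> tagged_fine d m \<sigma> \<eta> \<Longrightarrow>
      norm (S n \<tau> \<xi> - S m \<sigma> \<eta>) \<le> e / 2" using close[of "e / 2"] by auto
    obtain M where "\<And>q. q \<ge> M \<Longrightarrow> \<exists>n \<tau> \<xi>. tagged_fine d n \<tau> \<xi> \<and> s q = S n \<tau> \<xi>"
      using s_fine[OF d(1)] unfolding eventually_sequentially by blast
    then have "norm (s p - s q) \<le> e / 2" if "p \<ge> M" "q \<ge> M" for p q
      using that d(2) by metis
    then show "\<exists>M. \<forall>m\<ge>M. \<forall>n\<ge>M. norm (s m - s n) < e"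
      using \<open>e > 0\<close> by (intro exI[of _ M]) (smt (verit) field_sum_of_halves)
  qed
  then obtain I where I: "s \<longlonglongrightarrow> I"
    using Cauchy_convergent convergent_def by blast
  have "\<exists>d>0. \<forall>n \<tau> \<xi>. tagged_fine d n \<tau> \<xi> \<longrightarrow> norm (S n \<tau> \<xi> - I) < e" if e: "e > 0" for e
  proof -
    obtain d where d: "d > 0" "\<And>n \<tau> \<xi> m \<sigma> \<eta>. tagged_fine d n \<tau> \<xi> \<Longrightarrow> tagged_fine d m \<sigma> \<eta> \<Longrightarrow>
      norm (S n \<tau> \<xi> - S m \<sigma> \<eta>) \<le> e / 2" using close[of "e / 2"] e by auto
    have "norm (S n \<tau> \<xi> - I) < e" if "tagged_fine d n \<tau> \<xi>" for n \<tau> \<xi>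
    proof -
      have "\<forall>\<^sub>F q in sequentially. norm (S n \<tau> \<xi> - s q) \<le> e / 2"
        using s_fine[OF d(1)] by eventually_elim (use d(2) that in auto)
      then have "norm (S n \<tau> \<xi> - I) \<le> e / 2"
        by (intro tendsto_upperbound[OF tendsto_norm[OF tendsto_diff[OF tendsto_const I]]]) auto
      then show ?thesis using e by simp
    qed
    with d(1) show ?thesis by blast
  qed
  then have "has_rs_integral B f g a b I"
    unfolding has_rs_integral_def tagged_fine_def S_def by blast
  then show ?thesis by (rule that)
qed

text \<open>Sums tagged at left endpoints of uniform partitions satisfy exact algebraic identities.
  Bounds and relations for areas are proved for these sums and passed to the limit.\<close>

lemma has_rs_integral_uniform_limit:
  assumes "a < b" "has_rs_integral B f g a b I"
  shows "(\<lambda>q. \<Sum>j<q. B (f (a + (b - a) * real j / real q))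
    (g (a + (b - a) * real (Suc j) / real q) - g (a + (b - a) * real j / real q))) \<longlonglongrightarrow> I"
proof (rule LIMSEQ_I)
  fix e :: real assume "e > 0"
  then obtain d where d: "d > 0" "\<And>n \<tau> \<xi>. is_partition a b n \<tau> \<Longrightarrow>
      (\<forall>j<n. \<tau> (Suc j) - \<tau> j < d \<and> \<xi> j \<in> {\<tau> j..\<tau> (Suc j)}) \<Longrightarrow>
      norm ((\<Sum>j<n. B (f (\<xi> j)) (g (\<tau> (Suc j)) - g (\<tau> j))) - I) < e"
    using assms(2) unfolding has_rs_integral_def by meson
  obtain q0 where q0: "(b - a) / d < real q0"
    using reals_Archimedean2 by blast
  have "0 < (b - a) / d" using assms(1) d(1) by simp
  show "\<exists>q0. \<forall>q\<ge>q0. norm ((\<Sum>j<q. B (f (a + (b - a) * real j / real q))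
    (g (a + (b - a) * real (Suc j) / real q) - g (a + (b - a) * real j / real q))) - I) < e"
  proof (intro exI allI impI)
    fix q assume "q \<ge> q0"
    with q0 have q: "(b - a) / d < real q" by linarith
    with \<open>0 < (b - a) / d\<close> have "q > 0" by (cases q) auto
    have "(b - a) / q < d" using q \<open>q > 0\<close> d(1) by (simp add: field_simps)
    moreover note uniform_partition_step[OF \<open>q > 0\<close>, of a b]
    ultimately show "norm ((\<Sum>j<q. B (f (a + (b - a) * real j / real q))
      (g (a + (b - a) * real (Suc j) / real q) - g (a + (b - a) * real j / real q))) - I) < e"
      using assms(1) \<open>q > 0\<close>
      by (intro d(2) is_partition_uniform) (auto simp: divide_right_mono mult_left_mono)
  qed
qed

section \<open>The area of a path of finite 1-variation\<close>

text \<open>The inner integral telescopes to \<open>\<gamma> u - \<gamma> s\<close>, which leaves a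
  single integral of a continuous function against a path of finite 1-variation.\<close>

lemma has_rs_integral_area:
  fixes \<iota> :: "('v::banach, 'v) tensor \<Rightarrow> 'w::banach"
  assumes B: "bounded_bilinear (bracket \<iota>)" and \<gamma>: "\<gamma> \<in> C_1var T"
    and st: "0 \<le> s" "s < t" "t \<le> T"
  obtains I where "area \<iota> \<gamma> (s, t) = (1 / 2) *\<^sub>R I"
    "has_rs_integral (bracket \<iota>) (\<lambda>u. \<gamma> u - \<gamma> s) \<gamma> s t I"
proof -
  obtain v where v: "\<And>s t. 0 \<le> s \<Longrightarrow> s \<le> t \<Longrightarrow> t \<le> T \<Longrightarrow> norm (\<gamma> t - \<gamma> s) \<le> v t - v s"
    by (rule C_1var_control[OF \<gamma>]) blast
  have "continuous_on {s..t} \<gamma>"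
    using \<gamma> st continuous_on_subset[of "{0..T}" \<gamma> "{s..t}"] by (auto simp: C_1var_def)
  then have "continuous_on {s..t} (\<lambda>u. \<gamma> u - \<gamma> s)"
    by (intro continuous_intros)
  then obtain I where I: "has_rs_integral (bracket \<iota>) (\<lambda>u. \<gamma> u - \<gamma> s) \<gamma> s t I"
    by (rule has_rs_integral_exists[OF B st(2), of _ \<gamma> v]) (use st in \<open>auto intro: v\<close>)
  have "has_rs_integral (bracket \<iota>) (\<lambda>u. rs_integral scaleR (\<lambda>_. 1) \<gamma> s u) \<gamma> s t I"
    by (rule has_rs_integral_cong[OF _ I]) (simp add: rs_integral_one)
  then have "area \<iota> \<gamma> (s, t) = (1 / 2) *\<^sub>R I"
    using st by (simp add: area_def rs_integral_eq)
  with I show ?thesis using that by blast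
qed

lemma area_uniform_limit:
  fixes \<iota> :: "('v::banach, 'v) tensor \<Rightarrow> 'w::banach"
  assumes "bounded_bilinear (bracket \<iota>)" "\<gamma> \<in> C_1var T" "0 \<le> s" "s < t" "t \<le> T"
  shows "(\<lambda>q. (1 / 2) *\<^sub>R (\<Sum>i<q. bracket \<iota> (\<gamma> (s + (t - s) * real i / real q) - \<gamma> s)
    (\<gamma> (s + (t - s) * real (Suc i) / real q) - \<gamma> (s + (t - s) * real i / real q))))
    \<longlonglongrightarrow> area \<iota> \<gamma> (s, t)"
proof -
  obtain I where I: "area \<iota> \<gamma> (s, t) = (1 / 2) *\<^sub>R I"
    "has_rs_integral (bracket \<iota>) (\<lambda>u. \<gamma> u - \<gamma> s) \<gamma> s t I"
    using has_rs_integral_area[OF assms] .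
  show ?thesis
    unfolding I(1) by (intro tendsto_intros has_rs_integral_uniform_limit[OF assms(4) I(2)])
qed

text \<open>In every term of the approximating sum the factor \<open>\<gamma> u - \<gamma> s\<close>
  is at most the total growth of v. The area over [s, t] is therefore at most M (v t - v s), and
  these bounds telescope over a partition.\<close>

lemma area_finite_variation:
  fixes \<iota> :: "('v::banach, 'v) tensor \<Rightarrow> 'w::banach"
  assumes B: "bounded_bilinear (bracket \<iota>)" and \<gamma>: "\<gamma> \<in> C_1var T" and "T > 0"
  obtains C where "\<And>n \<tau>. is_partition 0 T n \<tau> \<Longrightarrow> (\<Sum>j<n. norm (area \<iota> \<gamma> (\<tau> j, \<tau> (Suc j)))) \<le> C"
proof -
  obtain v where v: "\<And>s t. 0 \<le> s \<Longrightarrow> s \<le> t \<Longrightarrow> t \<le> T \<Longrightarrow> norm (\<gamma> t - \<gamma> s) \<le> v t - v s"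
    by (rule C_1var_control[OF \<gamma>]) blast
  have v_mono: "v s \<le> v t" if "0 \<le> s" "s \<le> t" "t \<le> T" for s t
    using v[OF that] norm_ge_zero[of "\<gamma> t - \<gamma> s"] by linarith
  obtain K where K: "K > 0" "\<And>x y. norm (bracket \<iota> x y) \<le> norm x * norm y * K"
    using bounded_bilinear.pos_bounded[OF B] by blast
  define M where "M = (v T - v 0) * K"
  have le: "norm (area \<iota> \<gamma> (s, t)) \<le> M * (v t - v s)" if st: "0 \<le> s" "s < t" "t \<le> T" for s t
  proof (rule tendsto_upperbound[OF tendsto_norm[OF area_uniform_limit[OF B \<gamma> st]]])
    show "\<forall>\<^sub>F q in sequentially. norm ((1 / 2) *\<^sub>R
      (\<Sum>i<q. bracket \<iota> (\<gamma> (s + (t - s) * real i / real q) - \<gamma> s)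
        (\<gamma> (s + (t - s) * real (Suc i) / real q) - \<gamma> (s + (t - s) * real i / real q)))) \<le> M * (v t - v s)"
      using eventually_gt_at_top[of 0]
    proof eventually_elim
      case (elim q)
      define u where "u i = s + (t - s) * real i / real q" for i
      have u: "is_partition s t q u"
        unfolding u_def using is_partition_uniform[OF st(2) elim] .
      have "norm (\<Sum>i<q. bracket \<iota> (\<gamma> (u i) - \<gamma> s) (\<gamma> (u (Suc i)) - \<gamma> (u i)))
        \<le> (\<Sum>i<q. M * (v (u (Suc i)) - v (u i)))"
      proof (intro order_trans[OF norm_sum] sum_mono)
        fix i assume "i \<in> {..<q}"
        then have i: "u i \<in> {s..t}" "u (Suc i) \<in> {s..t}" "u i \<le> u (Suc i)"
          using is_partition_in[OF u, of i] is_partition_in[OF u, of "Suc i"]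
            is_partition_mono[OF u, of i "Suc i"] by auto
        have "norm (\<gamma> (u i) - \<gamma> s) \<le> v (u i) - v s"
          using i st by (intro v) auto
        also have "\<dots> \<le> v T - v 0"
          using v_mono[of "u i" T] v_mono[of 0 s] i st by auto
        finally have "norm (\<gamma> (u i) - \<gamma> s) * norm (\<gamma> (u (Suc i)) - \<gamma> (u i)) * K \<le>
            (v T - v 0) * (v (u (Suc i)) - v (u i)) * K"
          using i st K(1) v_mono[of 0 T] by (intro mult_right_mono mult_mono v) auto
        then show "norm (bracket \<iota> (\<gamma> (u i) - \<gamma> s) (\<gamma> (u (Suc i)) - \<gamma> (u i))) \<le>
            M * (v (u (Suc i)) - v (u i))"
          using K(2)[of "\<gamma> (u i) - \<gamma> s" "\<gamma> (u (Suc i)) - \<gamma> (u i)"] by (simp add: M_def mult_ac)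
      qed
      also have "\<dots> = M * (v t - v s)"
        using is_partition_telescope[OF u, of v] by (simp flip: sum_distrib_left)
      finally have le: "norm (\<Sum>i<q. bracket \<iota> (\<gamma> (u i) - \<gamma> s) (\<gamma> (u (Suc i)) - \<gamma> (u i))) \<le> M * (v t - v s)" .
      \<comment> \<open>The factor 1 / 2 of the area is simply discarded here.\<close>
      show ?case
        using le norm_ge_zero[of "\<Sum>i<q. bracket \<iota> (\<gamma> (u i) - \<gamma> s) (\<gamma> (u (Suc i)) - \<gamma> (u i))"]
        unfolding u_def norm_scaleR by linarith
    qed
  qed simp
  have "(\<Sum>j<n. norm (area \<iota> \<gamma> (\<tau> j, \<tau> (Suc j)))) \<le> M * (v T - v 0)"
    if \<tau>: "is_partition 0 T n \<tau>" for n \<tau>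
  proof -
    have "(\<Sum>j<n. norm (area \<iota> \<gamma> (\<tau> j, \<tau> (Suc j)))) \<le> (\<Sum>j<n. M * (v (\<tau> (Suc j)) - v (\<tau> j)))"
    proof (intro sum_mono le)
      fix j assume "j \<in> {..<n}"
      then show "0 \<le> \<tau> j" "\<tau> j < \<tau> (Suc j)" "\<tau> (Suc j) \<le> T"
        using is_partition_in[OF \<tau>, of j] is_partition_in[OF \<tau>, of "Suc j"] \<tau>
        by (auto simp: is_partition_def)
    qed
    also have "\<dots> = M * (v T - v 0)"
      using is_partition_telescope[OF \<tau>, of v] by (simp flip: sum_distrib_left)
    finally show ?thesis .
  qed
  then show ?thesis by (rule that)
qed

text \<open>Chen's relation along a uniform partition; the discrete relation holds exactly for the
  approximating sums over a refinement, and passes to the limit.\<close>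

lemma area_uniform_Chen:
  fixes \<iota> :: "('v::banach, 'v) tensor \<Rightarrow> 'w::banach"
  assumes B: "bounded_bilinear (bracket \<iota>)" and \<gamma>: "\<gamma> \<in> C_1var T" and T: "T > 0" and n: "n > 0"
  defines "\<tau> \<equiv> \<lambda>j. T * real j / real n"
  shows "area \<iota> \<gamma> (0, T) = (\<Sum>j<n. area \<iota> \<gamma> (\<tau> j, \<tau> (Suc j))) +
    (1 / 2) *\<^sub>R (\<Sum>j<n. bracket \<iota> (\<gamma> (\<tau> j) - \<gamma> 0) (\<gamma> (\<tau> (Suc j)) - \<gamma> (\<tau> j)))"
proof -
  interpret bounded_bilinear "bracket \<iota>" by fact
  define S where "S s t q = (\<Sum>i<q. bracket \<iota> (\<gamma> (s + (t - s) * real i / real q) - \<gamma> s)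
    (\<gamma> (s + (t - s) * real (Suc i) / real q) - \<gamma> (s + (t - s) * real i / real q)))" for s t q
  have \<tau>: "is_partition 0 T n \<tau>"
    using is_partition_uniform[OF T n] by (simp add: \<tau>_def)
  have lim: "(\<lambda>q. (1 / 2) *\<^sub>R S s t q) \<longlonglongrightarrow> area \<iota> \<gamma> (s, t)" if "0 \<le> s" "s < t" "t \<le> T" for s t
    unfolding S_def using area_uniform_limit[OF B \<gamma> that] .
  have lim_j: "(\<lambda>q. (1 / 2) *\<^sub>R S (\<tau> j) (\<tau> (Suc j)) q) \<longlonglongrightarrow> area \<iota> \<gamma> (\<tau> j, \<tau> (Suc j))" if "j < n" for j
    using that is_partition_in[OF \<tau>, of j] is_partition_in[OF \<tau>, of "Suc j"] \<tau>
    by (intro lim) (auto simp: is_partition_def)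
  \<comment> \<open>Restricting to n * q pieces makes the fine uniform partition of [0, T] cut each
    of the n cells into q equal pieces.\<close>
  have "filterlim (\<lambda>q. n * q) sequentially sequentially"
    using n by (intro filterlim_subseq strict_monoI) simp
  then have lim_T: "(\<lambda>q. (1 / 2) *\<^sub>R S 0 T (n * q)) \<longlonglongrightarrow> area \<iota> \<gamma> (0, T)"
    using T by (intro filterlim_compose[OF lim]) auto
  have split: "S 0 T (n * q) = (\<Sum>j<n. S (\<tau> j) (\<tau> (Suc j)) q) +
      (\<Sum>j<n. bracket \<iota> (\<gamma> (\<tau> j) - \<gamma> 0) (\<gamma> (\<tau> (Suc j)) - \<gamma> (\<tau> j)))" if q: "q > 0" for q
  proof -
    define u where "u k = T * real k / real (n * q)" for k
    have u: "u (j * q + i) = \<tau> j + (\<tau> (Suc j) - \<tau> j) * real i / real q" for i j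
      using n q by (simp add: u_def \<tau>_def field_simps)
    have u_Suc: "u (Suc (j * q + i)) = \<tau> j + (\<tau> (Suc j) - \<tau> j) * real (Suc i) / real q" for i j
      using u[of j "Suc i"] by simp
    have block: "(\<Sum>k = j * q..<j * q + q. F k) = (\<Sum>i<q. F (j * q + i))" for j and F :: "nat \<Rightarrow> 'w"
      using sum.shift_bounds_nat_ivl[of F 0 "j * q" q] by (simp add: add.commute lessThan_atLeast0)
    have "S 0 T (n * q) = (\<Sum>k<n * q. bracket \<iota> (\<gamma> (u k) - \<gamma> 0) (\<gamma> (u (Suc k)) - \<gamma> (u k)))"
      by (simp add: S_def u_def)
    also have "\<dots> = (\<Sum>j<n. \<Sum>k = j * q..<j * q + q. bracket \<iota> (\<gamma> (u k) - \<gamma> 0) (\<gamma> (u (Suc k)) - \<gamma> (u k)))"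
      by (rule sum.nat_group[symmetric])
    also have "\<dots> = (\<Sum>j<n. \<Sum>i<q. bracket \<iota> (\<gamma> (u (j * q + i)) - \<gamma> 0)
        (\<gamma> (u (Suc (j * q + i))) - \<gamma> (u (j * q + i))))"
      by (simp only: block)
    also have "\<dots> = (\<Sum>j<n. S (\<tau> j) (\<tau> (Suc j)) q +
        bracket \<iota> (\<gamma> (\<tau> j) - \<gamma> 0) (\<gamma> (\<tau> (Suc j)) - \<gamma> (\<tau> j)))"
    proof (intro sum.cong refl)
      fix j assume "j \<in> {..<n}"
      let ?\<Delta> = "\<lambda>i. \<gamma> (u (Suc (j * q + i))) - \<gamma> (u (j * q + i))"
      \<comment> \<open>Within cell j the left factor splits as (\<gamma>(u) - \<gamma>(\<tau> j)) +
        (\<gamma>(\<tau> j) - \<gamma>(0)). The first part yields the local area sum; the second is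
        constant on the cell, so its increments telescope.\<close>
      have "(\<Sum>i<q. ?\<Delta> i) = \<gamma> (\<tau> (Suc j)) - \<gamma> (\<tau> j)"
        using sum_lessThan_telescope[of "\<lambda>i. \<gamma> (u (j * q + i))" q] q u[of j 0] u[of j q] by simp
      then have "bracket \<iota> (\<gamma> (\<tau> j) - \<gamma> 0) (\<gamma> (\<tau> (Suc j)) - \<gamma> (\<tau> j)) =
          (\<Sum>i<q. bracket \<iota> (\<gamma> (\<tau> j) - \<gamma> 0) (?\<Delta> i))"
        by (simp flip: sum_right)
      moreover have "S (\<tau> j) (\<tau> (Suc j)) q = (\<Sum>i<q. bracket \<iota> (\<gamma> (u (j * q + i)) - \<gamma> (\<tau> j)) (?\<Delta> i))"
        by (simp only: S_def u u_Suc)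
      ultimately show "(\<Sum>i<q. bracket \<iota> (\<gamma> (u (j * q + i)) - \<gamma> 0) (?\<Delta> i)) =
          S (\<tau> j) (\<tau> (Suc j)) q + bracket \<iota> (\<gamma> (\<tau> j) - \<gamma> 0) (\<gamma> (\<tau> (Suc j)) - \<gamma> (\<tau> j))"
        by (simp add: diff_left flip: sum.distrib)
    qed
    finally show ?thesis by (simp add: sum.distrib)
  qed
  have "(\<lambda>q. (\<Sum>j<n. (1 / 2) *\<^sub>R S (\<tau> j) (\<tau> (Suc j)) q) +
      (1 / 2) *\<^sub>R (\<Sum>j<n. bracket \<iota> (\<gamma> (\<tau> j) - \<gamma> 0) (\<gamma> (\<tau> (Suc j)) - \<gamma> (\<tau> j))))
    \<longlonglongrightarrow> (\<Sum>j<n. area \<iota> \<gamma> (\<tau> j, \<tau> (Suc j))) +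
      (1 / 2) *\<^sub>R (\<Sum>j<n. bracket \<iota> (\<gamma> (\<tau> j) - \<gamma> 0) (\<gamma> (\<tau> (Suc j)) - \<gamma> (\<tau> j)))"
    by (intro tendsto_add tendsto_sum lim_j tendsto_const) simp
  moreover have "\<forall>\<^sub>F q in sequentially. (\<Sum>j<n. (1 / 2) *\<^sub>R S (\<tau> j) (\<tau> (Suc j)) q) +
      (1 / 2) *\<^sub>R (\<Sum>j<n. bracket \<iota> (\<gamma> (\<tau> j) - \<gamma> 0) (\<gamma> (\<tau> (Suc j)) - \<gamma> (\<tau> j))) =
      (1 / 2) *\<^sub>R S 0 T (n * q)"
    using eventually_gt_at_top[of 0]
    by eventually_elim (simp only: split scaleR_add_right scaleR_sum_right)
  ultimately have "(\<lambda>q. (1 / 2) *\<^sub>R S 0 T (n * q)) \<longlonglongrightarrow> (\<Sum>j<n. area \<iota> \<gamma> (\<tau> j, \<tau> (Suc j))) +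
      (1 / 2) *\<^sub>R (\<Sum>j<n. bracket \<iota> (\<gamma> (\<tau> j) - \<gamma> 0) (\<gamma> (\<tau> (Suc j)) - \<gamma> (\<tau> j)))"
    by (rule Lim_transform_eventually)
  with lim_T show ?thesis by (rule LIMSEQ_unique)
qed

section \<open>Membership in G2\<close>

text \<open>From some index m0 on, the areas of the approximants are within 1 of \<alpha> in
  1-variation, and the single area at m0 has finite variation. All later areas thus share one bound,
  which Chen's relation transfers to the discrete areas of the approximants and then, for each fixed
  n, to those of \<gamma>.\<close>

lemma G2_uniform_area_bounded:
  fixes \<iota> :: "('v::banach, 'v) tensor \<Rightarrow> 'w::banach"
  assumes B: "bounded_bilinear (bracket \<iota>)" and "T > 0" and "\<gamma> \<in> G2 \<iota> T"
  obtains C where "\<And>n. n > 0 \<Longrightarrow> norm (\<Sum>j<n. bracket \<iota> (\<gamma> (T * real j / real n) - \<gamma> 0)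
    (\<gamma> (T * real (Suc j) / real n) - \<gamma> (T * real j / real n))) \<le> C"
proof -
  interpret bounded_bilinear "bracket \<iota>" by fact
  obtain \<alpha> where "geometric_2_rough_path \<iota> T \<gamma> \<alpha>"
    using assms(3) by (auto simp: G2_def)
  then obtain \<gamma>\<^sub>n where \<gamma>n: "\<And>m. \<gamma>\<^sub>n m \<in> C_1var T"
    and conv2: "\<And>e. e > 0 \<Longrightarrow> \<forall>\<^sub>F m in sequentially. \<forall>n \<tau>. is_partition 0 T n \<tau> \<longrightarrow>
          (\<Sum>j<n. (norm ((\<gamma> (\<tau> (Suc j)) - \<gamma>\<^sub>n m (\<tau> (Suc j))) - (\<gamma> (\<tau> j) - \<gamma>\<^sub>n m (\<tau> j))))\<^sup>2) \<le> e"
    and conv1: "\<And>e. e > 0 \<Longrightarrow> \<forall>\<^sub>F m in sequentially. \<forall>n \<tau>. is_partition 0 T n \<tau> \<longrightarrow>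
          (\<Sum>j<n. norm (\<alpha> (\<tau> j, \<tau> (Suc j)) - area \<iota> (\<gamma>\<^sub>n m) (\<tau> j, \<tau> (Suc j)))) \<le> e"
    unfolding geometric_2_rough_path_iff by blast
  define A where "A m n \<tau> = (\<Sum>j<n. norm (area \<iota> (\<gamma>\<^sub>n m) (\<tau> j, \<tau> (Suc j))))" for m n and \<tau> :: "nat \<Rightarrow> real"
  define D where "D m n \<tau> = (\<Sum>j<n. norm (\<alpha> (\<tau> j, \<tau> (Suc j)) - area \<iota> (\<gamma>\<^sub>n m) (\<tau> j, \<tau> (Suc j))))"
    for m n and \<tau> :: "nat \<Rightarrow> real"
  obtain m0 where m0: "\<And>m n \<tau>. m \<ge> m0 \<Longrightarrow> is_partition 0 T n \<tau> \<Longrightarrow> D m n \<tau> \<le> 1"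
    using conv1[of 1] unfolding D_def eventually_sequentially by auto
  obtain C0 where C0: "\<And>n \<tau>. is_partition 0 T n \<tau> \<Longrightarrow> A m0 n \<tau> \<le> C0"
    unfolding A_def using area_finite_variation[OF B \<gamma>n assms(2), of m0] by blast
  have A_le: "A m n \<tau> \<le> C0 + 2" if "m \<ge> m0" "is_partition 0 T n \<tau>" for m n \<tau>
  proof -
    \<comment> \<open>Used with x the value of \<alpha>, y the area at m and z the area at m0. The
      two distances to \<alpha> contribute the 2 in \<open>C0 + 2\<close>.\<close>
    have tri: "norm y \<le> norm z + norm (x - y) + norm (x - z)" for x y z :: 'w
    proof -
      have "norm ((z - (x - y)) + (x - z)) \<le> norm (z - (x - y)) + norm (x - z)"
        by (rule norm_triangle_ineq)
      then have "norm y \<le> norm (z - (x - y)) + norm (x - z)" by simp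
      then show ?thesis using norm_triangle_ineq4[of z "x - y"] by linarith
    qed
    have "A m n \<tau> \<le> A m0 n \<tau> + D m n \<tau> + D m0 n \<tau>"
      unfolding A_def D_def sum.distrib[symmetric] by (intro sum_mono tri)
    then show ?thesis using C0[OF that(2)] m0[OF that] m0[OF order_refl that(2)] by linarith
  qed
  show ?thesis
  \<comment> \<open>Chen's relation has two area terms, each at most \<open>C0 + 2\<close>, and its
    factor 1 / 2 doubles the total.\<close>
  proof (rule that[of "4 * (C0 + 2)"])
    fix n :: nat assume "n > 0"
    define \<tau> where "\<tau> j = T * real j / real n" for j
    have \<tau>: "is_partition 0 T n \<tau>"
      using is_partition_uniform[OF assms(2) \<open>n > 0\<close>] by (simp add: \<tau>_def[abs_def])
    define R where "R \<eta> = (\<Sum>j<n. bracket \<iota> (\<eta> (\<tau> j) - \<eta> 0) (\<eta> (\<tau> (Suc j)) - \<eta> (\<tau> j)))" for \<eta>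
    have R_le: "norm (R (\<gamma>\<^sub>n m)) \<le> 4 * (C0 + 2)" if "m \<ge> m0" for m
    proof -
      \<comment> \<open>The trivial partition bounds the area over the whole of [0, T].\<close>
      have "is_partition 0 T 1 (\<lambda>j. T * real j)"
        using assms(2) by (simp add: is_partition_def)
      then have "norm (area \<iota> (\<gamma>\<^sub>n m) (0, T)) \<le> C0 + 2"
        using A_le[OF that, of 1 "\<lambda>j. T * real j"] by (simp add: A_def)
      moreover have "norm (\<Sum>j<n. area \<iota> (\<gamma>\<^sub>n m) (\<tau> j, \<tau> (Suc j))) \<le> C0 + 2"
        using A_le[OF that \<tau>] unfolding A_def by (rule order_trans[OF norm_sum])
      moreover have "(1 / 2) *\<^sub>R R (\<gamma>\<^sub>n m) =
          area \<iota> (\<gamma>\<^sub>n m) (0, T) - (\<Sum>j<n. area \<iota> (\<gamma>\<^sub>n m) (\<tau> j, \<tau> (Suc j)))"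
        unfolding R_def \<tau>_def using area_uniform_Chen[OF B \<gamma>n assms(2) \<open>n > 0\<close>] by simp
      ultimately have "norm ((1 / 2) *\<^sub>R R (\<gamma>\<^sub>n m)) \<le> 2 * (C0 + 2)"
        using norm_triangle_ineq4[of "area \<iota> (\<gamma>\<^sub>n m) (0, T)" "\<Sum>j<n. area \<iota> (\<gamma>\<^sub>n m) (\<tau> j, \<tau> (Suc j))"]
        by simp
      then show ?thesis by simp
    qed
    have incr: "(\<lambda>m. \<gamma>\<^sub>n m (\<tau> (Suc j)) - \<gamma>\<^sub>n m (\<tau> j)) \<longlonglongrightarrow> \<gamma> (\<tau> (Suc j)) - \<gamma> (\<tau> j)" if "j < n" for j
    proof (rule LIMSEQ_I)
      fix e :: real assume "e > 0"
      then have "\<forall>\<^sub>F m in sequentially. \<forall>n \<tau>. is_partition 0 T n \<tau> \<longrightarrow>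
          (\<Sum>j<n. (norm ((\<gamma> (\<tau> (Suc j)) - \<gamma>\<^sub>n m (\<tau> (Suc j))) - (\<gamma> (\<tau> j) - \<gamma>\<^sub>n m (\<tau> j))))\<^sup>2) \<le> (e / 2)\<^sup>2"
        by (intro conv2) simp
      then have "\<forall>\<^sub>F m in sequentially.
          norm ((\<gamma>\<^sub>n m (\<tau> (Suc j)) - \<gamma>\<^sub>n m (\<tau> j)) - (\<gamma> (\<tau> (Suc j)) - \<gamma> (\<tau> j))) < e"
      proof eventually_elim
        case (elim m)
        let ?\<delta> = "\<lambda>j. (\<gamma> (\<tau> (Suc j)) - \<gamma>\<^sub>n m (\<tau> (Suc j))) - (\<gamma> (\<tau> j) - \<gamma>\<^sub>n m (\<tau> j))"
        have "(norm (?\<delta> j))\<^sup>2 \<le> (\<Sum>j<n. (norm (?\<delta> j))\<^sup>2)"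
          using that by (intro member_le_sum) auto
        also have "\<dots> \<le> (e / 2)\<^sup>2" using elim \<tau> by blast
        finally have "norm (?\<delta> j) \<le> e / 2"
          by (rule power2_le_imp_le) (use \<open>e > 0\<close> in simp)
        also have "\<dots> < e" using \<open>e > 0\<close> by simp
        finally have "norm (- ?\<delta> j) < e" by (simp only: norm_minus_cancel)
        then show ?case by (simp add: algebra_simps)
      qed
      then show "\<exists>m0. \<forall>m\<ge>m0. norm ((\<gamma>\<^sub>n m (\<tau> (Suc j)) - \<gamma>\<^sub>n m (\<tau> j)) - (\<gamma> (\<tau> (Suc j)) - \<gamma> (\<tau> j))) < e"
        by (simp add: eventually_sequentially)
    qed
    \<comment> \<open>The 2-variation ignores additive constants, so values need not converge.
      Differences from the starting value do, as finite sums of increments.\<close>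
    have base: "(\<lambda>m. \<gamma>\<^sub>n m (\<tau> j) - \<gamma>\<^sub>n m 0) \<longlonglongrightarrow> \<gamma> (\<tau> j) - \<gamma> 0" if "j \<le> n" for j
    proof -
      have "(\<Sum>i<j. \<eta> (\<tau> (Suc i)) - \<eta> (\<tau> i)) = \<eta> (\<tau> j) - \<eta> 0" for \<eta> :: "real \<Rightarrow> 'v"
        using sum_lessThan_telescope[of "\<lambda>i. \<eta> (\<tau> i)" j] by (simp add: \<tau>_def)
      moreover have "(\<lambda>m. \<Sum>i<j. \<gamma>\<^sub>n m (\<tau> (Suc i)) - \<gamma>\<^sub>n m (\<tau> i)) \<longlonglongrightarrow>
          (\<Sum>i<j. \<gamma> (\<tau> (Suc i)) - \<gamma> (\<tau> i))"
        using that by (intro tendsto_sum incr) simp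
      ultimately show ?thesis by simp
    qed
    have "(\<lambda>m. R (\<gamma>\<^sub>n m)) \<longlonglongrightarrow> R \<gamma>"
      unfolding R_def by (intro tendsto_sum tendsto incr base) auto
    moreover have "\<forall>\<^sub>F m in sequentially. norm (R (\<gamma>\<^sub>n m)) \<le> 4 * (C0 + 2)"
      using eventually_ge_at_top[of m0] by eventually_elim (rule R_le)
    ultimately have "norm (R \<gamma>) \<le> 4 * (C0 + 2)"
      by (intro tendsto_upperbound[OF tendsto_norm]) auto
    then show "norm (\<Sum>j<n. bracket \<iota> (\<gamma> (T * real j / real n) - \<gamma> 0)
        (\<gamma> (T * real (Suc j) / real n) - \<gamma> (T * real j / real n))) \<le> 4 * (C0 + 2)"
      by (simp only: R_def \<tau>_def)
  qed
qed

section \<open>Approximation by paths on a line\<close>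

lemma bracket_multiples:
  assumes "bounded_bilinear (bracket \<iota>)"
  shows "bracket \<iota> (a *\<^sub>R e) (b *\<^sub>R e) = 0"
  using assms by (simp add: bounded_bilinear.scaleR_left bounded_bilinear.scaleR_right)

lemma area_multiples:
  fixes \<iota> :: "('v::banach, 'v) tensor \<Rightarrow> 'w::banach"
  assumes B: "bounded_bilinear (bracket \<iota>)" and \<gamma>: "\<And>t. \<exists>c. \<gamma> t = c *\<^sub>R e" and "s \<le> t"
  shows "area \<iota> \<gamma> (s, t) = 0"
proof -
  obtain x where x: "\<gamma> = (\<lambda>t. x t *\<^sub>R e)"
    using \<gamma> by metis
  have "bracket \<iota> (\<gamma> u - \<gamma> s) (\<gamma> u' - \<gamma> u'') = 0" for u u' u''
    by (simp add: x bracket_multiples[OF B] flip: scaleR_diff_left)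
  then have "has_rs_integral (bracket \<iota>) (\<lambda>u. \<gamma> u - \<gamma> s) \<gamma> s t 0"
    by (auto simp: has_rs_integral_def intro: exI[of _ 1])
  then have "has_rs_integral (bracket \<iota>) (\<lambda>u. rs_integral scaleR (\<lambda>_. 1) \<gamma> s u) \<gamma> s t 0"
    by (rule has_rs_integral_cong[rotated]) (simp add: rs_integral_one)
  then show ?thesis
    using assms(3) by (simp add: area_def rs_integral_eq)
qed

text \<open>The approximants have zero area, so the area part of the distance to the zero
  enhancement vanishes identically. This serves both the one-dimensional case and the two summands
  of the counterexample.\<close>

lemma geometric_2_rough_path_multiplesI:
  fixes \<iota> :: "('v::banach, 'v) tensor \<Rightarrow> 'w::banach"
  assumes B: "bounded_bilinear (bracket \<iota>)" and "continuous_on {0..T} \<gamma>"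
    and \<gamma>n: "\<And>m. \<gamma>\<^sub>n m \<in> C_1var T" "\<And>m t. \<exists>c. \<gamma>\<^sub>n m t = c *\<^sub>R e"
    and conv: "\<And>d. d > 0 \<Longrightarrow> \<forall>\<^sub>F m in sequentially. \<forall>n \<tau>. is_partition 0 T n \<tau> \<longrightarrow>
      (\<Sum>j<n. (norm ((\<gamma> (\<tau> (Suc j)) - \<gamma>\<^sub>n m (\<tau> (Suc j))) - (\<gamma> (\<tau> j) - \<gamma>\<^sub>n m (\<tau> j))))\<^sup>2) \<le> d"
  shows "geometric_2_rough_path \<iota> T \<gamma> (\<lambda>_. 0)"
proof -
  have "0 \<in> span {bracket \<iota> v\<^sub>1 v\<^sub>2 |v\<^sub>1 v\<^sub>2. True}"
    by (rule span_zero)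
  then have "(\<lambda>_. 0) \<in> C_triangle T (bracket_space \<iota>)"
    using closure_subset by (force simp: C_triangle_def bracket_space_def)
  moreover have "(\<Sum>j<n. norm (0 - area \<iota> (\<gamma>\<^sub>n m) (\<tau> j, \<tau> (Suc j)))) = 0"
    if "is_partition 0 T n \<tau>" for m n \<tau>
    using that by (simp add: area_multiples[OF B \<gamma>n(2)] is_partition_def less_imp_le)
  ultimately show ?thesis
    unfolding geometric_2_rough_path_iff using assms by (intro conjI exI[of _ \<gamma>\<^sub>n]) auto
qed

lemma lipschitz_C_1var:
  assumes "L-lipschitz_on {0..T} \<gamma>"
  shows "\<gamma> \<in> C_1var T"
proof -
  have L: "L \<ge> 0" using assms by (rule lipschitz_on_nonneg)
  \<comment> \<open>T carries no sign condition; the absolute value keeps the bound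
    nonnegative.\<close>
  have "(\<Sum>j<n. norm (\<gamma> (\<tau> (Suc j)) - \<gamma> (\<tau> j))) \<le> L * \<bar>T\<bar>" if \<tau>: "is_partition 0 T n \<tau>" for n \<tau>
  proof -
    have "(\<Sum>j<n. norm (\<gamma> (\<tau> (Suc j)) - \<gamma> (\<tau> j))) \<le> (\<Sum>j<n. L * (\<tau> (Suc j) - \<tau> j))"
    proof (intro sum_mono)
      fix j assume "j \<in> {..<n}"
      then show "norm (\<gamma> (\<tau> (Suc j)) - \<gamma> (\<tau> j)) \<le> L * (\<tau> (Suc j) - \<tau> j)"
        using lipschitz_onD[OF assms, of "\<tau> (Suc j)" "\<tau> j"] is_partition_in[OF \<tau>, of j]
          is_partition_in[OF \<tau>, of "Suc j"] is_partition_mono[OF \<tau>, of j "Suc j"]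
        by (simp add: dist_norm)
    qed
    also have "\<dots> = L * (T - 0)"
      using is_partition_telescope[OF \<tau>, of "\<lambda>x. x"] by (simp flip: sum_distrib_left)
    also have "\<dots> \<le> L * \<bar>T\<bar>" using L by (intro mult_left_mono) auto
    finally show ?thesis .
  qed
  then show ?thesis
    using L lipschitz_on_continuous_on[OF assms] unfolding C_1var_iff
    by (intro conjI exI[of _ "L * \<bar>T\<bar>"]) auto
qed

text \<open>The square of a 1/2-Hoelder bound is linear in the length of the step, so it telescopes
  over any partition.\<close>

lemma sum_squares_partition_le:
  fixes \<gamma> :: "real \<Rightarrow> 'v::real_normed_vector"
  assumes \<tau>: "is_partition 0 T n \<tau>"
    and le: "\<And>j. j < n \<Longrightarrow> (norm (\<gamma> (\<tau> (Suc j)) - \<gamma> (\<tau> j)))\<^sup>2 \<le> K * (\<tau> (Suc j) - \<tau> j)"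
  shows "(\<Sum>j<n. (norm (\<gamma> (\<tau> (Suc j)) - \<gamma> (\<tau> j)))\<^sup>2) \<le> K * T"
proof -
  have "(\<Sum>j<n. (norm (\<gamma> (\<tau> (Suc j)) - \<gamma> (\<tau> j)))\<^sup>2) \<le> (\<Sum>j<n. K * (\<tau> (Suc j) - \<tau> j))"
    by (intro sum_mono le) simp
  also have "\<dots> = K * T"
    using is_partition_telescope[OF \<tau>, of "\<lambda>x. x"] by (simp flip: sum_distrib_left)
  finally show ?thesis .
qed

lemma norm_add_square_le:
  fixes a b :: "'a::real_normed_vector"
  shows "(norm (a + b))\<^sup>2 \<le> 2 * (norm a)\<^sup>2 + 2 * (norm b)\<^sup>2"
proof -
  have "(norm (a + b))\<^sup>2 \<le> (norm a + norm b)\<^sup>2"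
    by (intro power_mono norm_triangle_ineq) simp
  also have "\<dots> \<le> 2 * (norm a)\<^sup>2 + 2 * (norm b)\<^sup>2"
    using zero_le_power2[of "norm a - norm b"] by (simp add: power2_eq_square algebra_simps)
  finally show ?thesis .
qed

lemma G2_multiplesI:
  fixes \<iota> :: "('v::banach, 'v) tensor \<Rightarrow> 'w::banach"
  assumes B: "bounded_bilinear (bracket \<iota>)" and T: "T > 0" and cont: "continuous_on {0..T} \<gamma>"
    and approx: "\<And>d. d > 0 \<Longrightarrow> \<exists>L \<eta>. L-lipschitz_on {0..T} \<eta> \<and> (\<forall>t. \<exists>c. \<eta> t = c *\<^sub>R e) \<and>
      (\<forall>s\<in>{0..T}. \<forall>t\<in>{0..T}. s \<le> t \<longrightarrow> (norm ((\<gamma> t - \<eta> t) - (\<gamma> s - \<eta> s)))\<^sup>2 \<le> d * (t - s))"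
  shows "\<gamma> \<in> G2 \<iota> T"
proof -
  have "\<forall>m::nat. \<exists>\<eta>. \<eta> \<in> C_1var T \<and> (\<forall>t. \<exists>c. \<eta> t = c *\<^sub>R e) \<and>
      (\<forall>s\<in>{0..T}. \<forall>t\<in>{0..T}. s \<le> t \<longrightarrow>
        (norm ((\<gamma> t - \<eta> t) - (\<gamma> s - \<eta> s)))\<^sup>2 \<le> inverse (real (Suc m)) * (t - s))"
    using approx lipschitz_C_1var by (metis inverse_positive_iff_positive of_nat_0_less_iff zero_less_Suc)
  then obtain \<eta> where \<eta>: "\<And>m. \<eta> m \<in> C_1var T" "\<And>m t. \<exists>c. \<eta> m t = c *\<^sub>R e"
    "\<And>m s t. s \<in> {0..T} \<Longrightarrow> t \<in> {0..T} \<Longrightarrow> s \<le> t \<Longrightarrow>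
      (norm ((\<gamma> t - \<eta> m t) - (\<gamma> s - \<eta> m s)))\<^sup>2 \<le> inverse (real (Suc m)) * (t - s)"
    by metis
  have "geometric_2_rough_path \<iota> T \<gamma> (\<lambda>_. 0)"
  proof (rule geometric_2_rough_path_multiplesI[OF B cont \<eta>(1,2)])
    fix d :: real assume "d > 0"
    have "(\<lambda>m. inverse (real (Suc m)) * T) \<longlonglongrightarrow> 0 * T"
      by (intro tendsto_intros LIMSEQ_inverse_real_of_nat)
    then have "\<forall>\<^sub>F m in sequentially. inverse (real (Suc m)) * T < d"
      using \<open>d > 0\<close> order_tendstoD(2) by fastforce
    then show "\<forall>\<^sub>F m in sequentially. \<forall>n \<tau>. is_partition 0 T n \<tau> \<longrightarrow>
      (\<Sum>j<n. (norm ((\<gamma> (\<tau> (Suc j)) - \<eta> m (\<tau> (Suc j))) - (\<gamma> (\<tau> j) - \<eta> m (\<tau> j))))\<^sup>2) \<le> d"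
    proof eventually_elim
      case (elim m)
      show ?case
      proof (intro allI impI)
        fix n \<tau> assume \<tau>: "is_partition 0 T n \<tau>"
        have "(\<Sum>j<n. (norm ((\<gamma> (\<tau> (Suc j)) - \<eta> m (\<tau> (Suc j))) - (\<gamma> (\<tau> j) - \<eta> m (\<tau> j))))\<^sup>2)
          \<le> inverse (real (Suc m)) * T"
          using \<tau> by (intro sum_squares_partition_le \<eta>(3) is_partition_in[OF \<tau>]
              is_partition_mono[OF \<tau>]) auto
        with elim show "(\<Sum>j<n. (norm ((\<gamma> (\<tau> (Suc j)) - \<eta> m (\<tau> (Suc j))) - (\<gamma> (\<tau> j) - \<eta> m (\<tau> j))))\<^sup>2) \<le> d"
          by linarith
      qed
    qed
  qed
  moreover have "vanishing_2_variation T \<gamma>"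
    unfolding vanishing_2_variation_iff
  proof (intro allI impI)
    fix d :: real assume "d > 0"
    then have "d / (4 * T) > 0" using T by simp
    then obtain L \<eta> where L: "L-lipschitz_on {0..T} \<eta>"
      and \<eta>: "\<And>s t. s \<in> {0..T} \<Longrightarrow> t \<in> {0..T} \<Longrightarrow> s \<le> t \<Longrightarrow>
        (norm ((\<gamma> t - \<eta> t) - (\<gamma> s - \<eta> s)))\<^sup>2 \<le> d / (4 * T) * (t - s)"
      using approx[of "d / (4 * T)"] by metis
    \<comment> \<open>Remainder and Lipschitz part each enter with the factor 2 of
      \<open>norm_add_square_le\<close>, so each may use d / (4 T) per unit length. The summand 1
      covers L = 0.\<close>
    define \<delta> where "\<delta> = d / (4 * T * (L\<^sup>2 + 1))"
    have pos: "L\<^sup>2 + 1 > 0" by (simp add: add_nonneg_pos)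
    then have "\<delta> > 0" and eq: "(L\<^sup>2 + 1) * \<delta> = d / (4 * T)"
      using T \<open>d > 0\<close> by (simp_all add: \<delta>_def)
    then have \<delta>: "\<delta> > 0" "L\<^sup>2 * \<delta> \<le> d / (4 * T)"
      unfolding eq[symmetric] by (simp_all add: distrib_right)
    have "(\<Sum>j<n. (norm (\<gamma> (\<tau> (Suc j)) - \<gamma> (\<tau> j)))\<^sup>2) \<le> d"
      if \<tau>: "is_partition 0 T n \<tau>" "\<forall>j<n. \<tau> (Suc j) - \<tau> j \<le> \<delta>" for n \<tau>
    proof -
      have "(\<Sum>j<n. (norm (\<gamma> (\<tau> (Suc j)) - \<gamma> (\<tau> j)))\<^sup>2) \<le> (d / T) * T"
      proof (rule sum_squares_partition_le[OF \<tau>(1)])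
        fix j assume "j < n"
        define h where "h = \<tau> (Suc j) - \<tau> j"
        have j: "\<tau> j \<in> {0..T}" "\<tau> (Suc j) \<in> {0..T}" "\<tau> j \<le> \<tau> (Suc j)"
          using \<open>j < n\<close> is_partition_in[OF \<tau>(1)] is_partition_mono[OF \<tau>(1)] by auto
        have h: "0 \<le> h" "h \<le> \<delta>" using j \<tau>(2) \<open>j < n\<close> by (auto simp: h_def)
        have "norm (\<eta> (\<tau> (Suc j)) - \<eta> (\<tau> j)) \<le> L * h"
          using lipschitz_onD[OF L j(2,1)] j by (simp add: dist_norm h_def)
        then have "(norm (\<eta> (\<tau> (Suc j)) - \<eta> (\<tau> j)))\<^sup>2 \<le> (L * h)\<^sup>2"
          by (intro power_mono) auto
        also have "\<dots> = L\<^sup>2 * h * h" by (simp add: power2_eq_square)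
        also have "\<dots> \<le> L\<^sup>2 * \<delta> * h"
          using h by (intro mult_right_mono mult_left_mono) auto
        also have "\<dots> \<le> d / (4 * T) * h"
          using h \<delta>(2) by (intro mult_right_mono) auto
        finally have "2 * (norm ((\<gamma> (\<tau> (Suc j)) - \<eta> (\<tau> (Suc j))) - (\<gamma> (\<tau> j) - \<eta> (\<tau> j))))\<^sup>2 +
            2 * (norm (\<eta> (\<tau> (Suc j)) - \<eta> (\<tau> j)))\<^sup>2 \<le> 4 * (d / (4 * T) * h)"
          using \<eta>[OF j] unfolding h_def[symmetric] by linarith
        then show "(norm (\<gamma> (\<tau> (Suc j)) - \<gamma> (\<tau> j)))\<^sup>2 \<le> d / T * (\<tau> (Suc j) - \<tau> j)"
          using norm_add_square_le[of "(\<gamma> (\<tau> (Suc j)) - \<eta> (\<tau> (Suc j))) - (\<gamma> (\<tau> j) - \<eta> (\<tau> j))"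
              "\<eta> (\<tau> (Suc j)) - \<eta> (\<tau> j)"] T
          by (simp add: h_def)
      qed
      also have "\<dots> = d" using T by simp
      finally show ?thesis .
    qed
    with \<delta>(1) show "\<exists>\<delta>>0. \<forall>n \<tau>. is_partition 0 T n \<tau> \<longrightarrow> (\<forall>j<n. \<tau> (Suc j) - \<tau> j \<le> \<delta>) \<longrightarrow>
        (\<Sum>j<n. (norm (\<gamma> (\<tau> (Suc j)) - \<gamma> (\<tau> j)))\<^sup>2) \<le> d"
      by blast
  qed
  ultimately show ?thesis
    using cont by (auto simp: G2_def)
qed

section \<open>Lacunary series\<close>

text \<open>Chosen so that the square times 4^k is exactly 1 / (k + 1).\<close>

definition lacunary_coeff :: "nat \<Rightarrow> real" where
  "lacunary_coeff k = (1 / 2) ^ k / sqrt (real (Suc k))"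

definition lacunary :: "(real \<Rightarrow> real) \<Rightarrow> real \<Rightarrow> real" where
  "lacunary h t = suminf (\<lambda>k. lacunary_coeff k * h (4 ^ k * t))"

lemma lacunary_coeff_nonneg: "0 \<le> lacunary_coeff k"
  by (simp add: lacunary_coeff_def)

lemma lacunary_coeff_le: "lacunary_coeff (k + m) \<le> (1 / 2) ^ (k + m) / sqrt (real (Suc m))"
  unfolding lacunary_coeff_def by (intro divide_left_mono) auto

lemma summable_lacunary_coeff: "summable lacunary_coeff"
proof (rule summable_comparison_test')
  show "summable (\<lambda>k. (1 / 2 :: real) ^ k)"
    by (rule summable_geometric) simp
  show "norm (lacunary_coeff k) \<le> (1 / 2) ^ k" for k
    using lacunary_coeff_nonneg[of k] lacunary_coeff_le[of k 0] by simp
qed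

lemma summable_lacunary:
  assumes "\<And>x. \<bar>h x\<bar> \<le> 1"
  shows "summable (\<lambda>k. lacunary_coeff k * h (4 ^ k * t))"
proof (rule summable_comparison_test'[OF summable_lacunary_coeff])
  show "norm (lacunary_coeff k * h (4 ^ k * t)) \<le> lacunary_coeff k" for k
    using mult_left_mono[OF assms lacunary_coeff_nonneg] by (simp add: abs_mult lacunary_coeff_nonneg)
qed

text \<open>The two competing bounds of the terms balance at \<open>2 ^ K = 1 / r\<close>.\<close>

lemma sum_min_dyadic_le:
  fixes r :: real
  assumes "r > 0"
  shows "(\<Sum>k<N. (1 / 2) ^ k * min 2 (4 ^ k * r\<^sup>2)) \<le> 6 * r"
proof -
  define F where "F k = (1 / 2) ^ k * min 2 (4 ^ k * r\<^sup>2)" for k :: nat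
  have "\<exists>K. 1 \<le> 2 ^ K * r"
    using real_arch_pow[of 2 "1 / r"] assms by (auto simp: field_simps intro: less_imp_le)
  \<comment> \<open>K is the least such exponent. Below it the terms 2^k r^2 sum to less than 2^K
    r^2 \<le> 2 r by minimality; from it on, the bound 2 gives at most 4 (1/2)^K \<le> 4 r. Together
    this is the constant 6.\<close>
  then have "\<exists>K. 1 \<le> 2 ^ K * r \<and> (\<forall>k<K. \<not> 1 \<le> 2 ^ k * r)"
    by (rule exists_least_iff[THEN iffD1])
  then obtain K where K: "1 \<le> 2 ^ K * r" "\<And>k. k < K \<Longrightarrow> 2 ^ k * r < 1"
    by (auto simp: not_le)
  have low: "(\<Sum>k<K. F k) \<le> 2 * r"
  proof -
    have "F k \<le> 2 ^ k * r\<^sup>2" for k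
    proof -
      have "F k \<le> (1 / 2) ^ k * (4 ^ k * r\<^sup>2)"
        unfolding F_def by (intro mult_left_mono) auto
      also have "\<dots> = ((1 / 2) * 4) ^ k * r\<^sup>2" by (simp only: power_mult_distrib mult.assoc)
      finally show ?thesis by simp
    qed
    then have "(\<Sum>k<K. F k) \<le> (\<Sum>k<K. 2 ^ k * r\<^sup>2)" by (rule sum_mono)
    also have "\<dots> = (2 ^ K - 1) * r\<^sup>2"
      by (induction K) (auto simp: algebra_simps)
    also have "\<dots> \<le> 2 * r"
    proof (cases K)
      case (Suc k)
      have "2 ^ K * r\<^sup>2 = 2 * r * (2 ^ k * r)" by (simp add: Suc power2_eq_square)
      also have "\<dots> \<le> 2 * r * 1"
        using K(2)[of k] Suc assms by (intro mult_left_mono) auto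
      finally have "2 ^ K * r\<^sup>2 \<le> 2 * r" by simp
      moreover have "(2 ^ K - 1) * r\<^sup>2 \<le> 2 ^ K * r\<^sup>2" by (intro mult_right_mono) auto
      ultimately show ?thesis by linarith
    qed (use assms in simp)
    finally show ?thesis .
  qed
  have high: "(\<Sum>k<N. F (k + K)) \<le> 4 * r"
  proof -
    have "(\<Sum>k<N. F (k + K)) \<le> (\<Sum>k<N. (1 / 2) ^ (k + K) * 2)"
      unfolding F_def by (intro sum_mono mult_left_mono) auto
    also have "\<dots> = 4 * (1 / 2) ^ K * (1 - (1 / 2) ^ N)"
      by (induction N) (auto simp: algebra_simps power_add)
    also have "\<dots> \<le> 4 * (1 / 2) ^ K" by (simp add: mult_le_cancel_left1)
    also have "\<dots> \<le> 4 * (1 / 2) ^ K * (2 ^ K * r)"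
      using mult_left_mono[OF K(1), of "4 * (1 / 2) ^ K"] by simp
    also have "\<dots> = 4 * ((1 / 2) * 2) ^ K * r"
      by (simp only: power_mult_distrib mult.assoc)
    finally show ?thesis by simp
  qed
  have "(\<Sum>k<N. F k) \<le> (\<Sum>k<N + K. F k)"
    by (rule sum_mono2) (auto simp: F_def)
  also have "\<dots> = (\<Sum>k<K. F k) + (\<Sum>k<N. F (k + K))"
    by (induction N) auto
  finally show ?thesis using low high by (simp add: F_def)
qed

text \<open>A difference of values of h is bounded both by 2 and by the Lipschitz bound 4^k |t - s|.
  Taking 1 / sqrt (m + 1) out of the tail coefficients leaves the dyadic sum with r^2 = |t -
  s|.\<close>

lemma lacunary_tail_le:
  assumes h: "\<And>x. \<bar>h x\<bar> \<le> 1" "\<And>x y. \<bar>h x - h y\<bar> \<le> \<bar>x - y\<bar>"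
  shows "\<bar>(lacunary h t - (\<Sum>k<m. lacunary_coeff k * h (4 ^ k * t))) -
    (lacunary h s - (\<Sum>k<m. lacunary_coeff k * h (4 ^ k * s)))\<bar>
    \<le> 6 / sqrt (real (Suc m)) * sqrt \<bar>t - s\<bar>"
proof (cases "t = s")
  case False
  define r where "r = sqrt \<bar>t - s\<bar>"
  have r: "r > 0" "r\<^sup>2 = \<bar>t - s\<bar>" using False by (auto simp: r_def)
  define u where "u k = lacunary_coeff k * h (4 ^ k * t)" for k
  define v where "v k = lacunary_coeff k * h (4 ^ k * s)" for k
  have sum_uv: "summable u" "summable v"
    unfolding u_def v_def by (rule summable_lacunary[OF h(1)])+
  define w where "w k = u (k + m) - v (k + m)" for k
  define A where "A = 1 / sqrt (real (Suc m))"
  have A: "A \<ge> 0" by (simp add: A_def)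
  have tail_le: "lacunary_coeff (k + m) * min 2 (4 ^ (k + m) * r\<^sup>2) \<le>
      A * ((1 / 2) ^ (k + m) * min 2 (4 ^ (k + m) * r\<^sup>2))" for k
    using mult_right_mono[OF lacunary_coeff_le[of k m], of "min 2 (4 ^ (k + m) * r\<^sup>2)"]
    by (simp add: A_def)
  have w_le: "\<bar>w k\<bar> \<le> A * ((1 / 2) ^ (k + m) * min 2 (4 ^ (k + m) * r\<^sup>2))" for k
  proof -
    have "\<bar>h (4 ^ (k + m) * t) - h (4 ^ (k + m) * s)\<bar> \<le> \<bar>4 ^ (k + m) * t - 4 ^ (k + m) * s\<bar>"
      by (rule h(2))
    also have "\<dots> = 4 ^ (k + m) * r\<^sup>2"
      unfolding r(2) by (simp only: right_diff_distrib[symmetric] abs_mult) simp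
    finally have "\<bar>h (4 ^ (k + m) * t) - h (4 ^ (k + m) * s)\<bar> \<le> min 2 (4 ^ (k + m) * r\<^sup>2)"
      using h(1)[of "4 ^ (k + m) * t"] h(1)[of "4 ^ (k + m) * s"] by auto
    then have "lacunary_coeff (k + m) * \<bar>h (4 ^ (k + m) * t) - h (4 ^ (k + m) * s)\<bar> \<le>
        lacunary_coeff (k + m) * min 2 (4 ^ (k + m) * r\<^sup>2)"
      by (rule mult_left_mono[OF _ lacunary_coeff_nonneg])
    moreover have "\<bar>w k\<bar> = lacunary_coeff (k + m) * \<bar>h (4 ^ (k + m) * t) - h (4 ^ (k + m) * s)\<bar>"
      by (simp add: w_def u_def v_def abs_mult lacunary_coeff_nonneg flip: right_diff_distrib)
    ultimately show ?thesis using tail_le[of k] by linarith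
  qed
  have sums_le: "(\<Sum>k<N. \<bar>w k\<bar>) \<le> 6 * A * r" for N
  proof -
    have "(\<Sum>k<N. (1 / 2) ^ (k + m) * min 2 (4 ^ (k + m) * r\<^sup>2)) =
        (\<Sum>k\<in>{0 + m..<N + m}. (1 / 2) ^ k * min 2 (4 ^ k * r\<^sup>2))"
      unfolding sum.shift_bounds_nat_ivl by (simp add: lessThan_atLeast0)
    also have "\<dots> \<le> (\<Sum>k<N + m. (1 / 2) ^ k * min 2 (4 ^ k * r\<^sup>2))"
      by (rule sum_mono2) auto
    also have "\<dots> \<le> 6 * r" by (rule sum_min_dyadic_le[OF r(1)])
    finally have "A * (\<Sum>k<N. (1 / 2) ^ (k + m) * min 2 (4 ^ (k + m) * r\<^sup>2)) \<le> A * (6 * r)"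
      using A by (rule mult_left_mono)
    moreover have "(\<Sum>k<N. \<bar>w k\<bar>) \<le> A * (\<Sum>k<N. (1 / 2) ^ (k + m) * min 2 (4 ^ (k + m) * r\<^sup>2))"
      unfolding sum_distrib_left by (intro sum_mono w_le)
    ultimately show ?thesis by (simp add: mult_ac)
  qed
  have abs_w: "summable (\<lambda>k. \<bar>w k\<bar>)"
  proof (rule bounded_imp_summable)
    show "(\<Sum>k\<le>N. \<bar>w k\<bar>) \<le> 6 * A * r" for N
      using sums_le[of "Suc N"] by (simp only: lessThan_Suc_atMost)
  qed simp
  have "\<bar>suminf w\<bar> \<le> suminf (\<lambda>k. \<bar>w k\<bar>)" by (rule summable_rabs[OF abs_w])
  also have "\<dots> \<le> 6 * A * r" by (rule suminf_le_const[OF abs_w sums_le])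
  finally have "\<bar>suminf w\<bar> \<le> 6 * A * r" .
  moreover have "suminf w = suminf (\<lambda>k. u (k + m)) - suminf (\<lambda>k. v (k + m))"
    unfolding w_def by (rule suminf_diff[symmetric]) (use sum_uv in \<open>simp_all add: summable_iff_shift\<close>)
  moreover have "suminf (\<lambda>k. u (k + m)) = lacunary h t - (\<Sum>k<m. u k)"
    "suminf (\<lambda>k. v (k + m)) = lacunary h s - (\<Sum>k<m. v k)"
    using suminf_minus_initial_segment[OF sum_uv(1), of m] suminf_minus_initial_segment[OF sum_uv(2), of m]
    by (simp_all add: lacunary_def u_def v_def)
  ultimately show ?thesis by (simp add: u_def v_def A_def r_def)
qed simp

text \<open>Partial sums are Lipschitz, and the tail after m terms is 1/2-Hoelder with a constant of
  order 1 / sqrt (m + 1), as \<open>G2_multiplesI\<close> demands.\<close>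

lemma lacunary_multiple_in_G2:
  fixes \<iota> :: "('v::banach, 'v) tensor \<Rightarrow> 'w::banach"
  assumes B: "bounded_bilinear (bracket \<iota>)" and T: "T > 0" and c: "c \<ge> 0"
    and h: "\<And>x. \<bar>h x\<bar> \<le> 1" "\<And>x y. \<bar>h x - h y\<bar> \<le> \<bar>x - y\<bar>"
  shows "(\<lambda>t. lacunary h (c * t) *\<^sub>R e) \<in> G2 \<iota> T"
proof (rule G2_multiplesI[OF B T, where e=e])
  define P where "P m t = (\<Sum>k<m. lacunary_coeff k * h (4 ^ k * (c * t)))" for m t
  have tail: "\<bar>(lacunary h (c * t) - P m t) - (lacunary h (c * s) - P m s)\<bar> \<le>
      6 / sqrt (real (Suc m)) * sqrt (c * \<bar>t - s\<bar>)" for m t s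
    using lacunary_tail_le[OF h, of "c * t" m "c * s"] c
    by (simp add: P_def abs_mult flip: right_diff_distrib)
  show "continuous_on {0..T} (\<lambda>t. lacunary h (c * t) *\<^sub>R e)"
  proof (intro continuous_on_scaleR continuous_on_const continuous_at_imp_continuous_on ballI)
    fix s
    have "((\<lambda>t. 6 * sqrt (c * \<bar>t - s\<bar>)) \<longlongrightarrow> 6 * sqrt (c * \<bar>s - s\<bar>)) (at s)"
      by (intro tendsto_intros)
    then have lim: "((\<lambda>t. 6 * sqrt (c * \<bar>t - s\<bar>)) \<longlongrightarrow> 0) (at s)" by simp
    \<comment> \<open>The tail after no terms is the whole series, so the same estimate yields
      continuity.\<close>
    have "norm (lacunary h (c * t) - lacunary h (c * s)) \<le> 6 * sqrt (c * \<bar>t - s\<bar>)" for t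
      using tail[of t 0 s] by (simp add: P_def)
    then have "((\<lambda>t. lacunary h (c * t) - lacunary h (c * s)) \<longlongrightarrow> 0) (at s)"
      by (rule Lim_null_comparison[OF always_eventually[OF allI] lim])
    then show "isCont (\<lambda>t. lacunary h (c * t)) s"
      unfolding isCont_def by (rule LIM_zero_cancel)
  qed
  fix d :: real assume "d > 0"
  \<comment> \<open>36 is the square of the constant 6 in the tail estimate.\<close>
  define Q where "Q = (norm e)\<^sup>2 * (36 * c)"
  have "(\<lambda>m. Q * inverse (real (Suc m))) \<longlonglongrightarrow> Q * 0"
    by (intro tendsto_intros LIMSEQ_inverse_real_of_nat)
  then have "\<forall>\<^sub>F m in sequentially. Q * inverse (real (Suc m)) < d"
    using \<open>d > 0\<close> order_tendstoD(2) by fastforce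
  then obtain m where m: "Q * inverse (real (Suc m)) < d"
    by (auto simp: eventually_sequentially)
  define L where "L = (\<Sum>k<m. lacunary_coeff k * (4 ^ k * c)) * norm e"
  have "L-lipschitz_on {0..T} (\<lambda>t. P m t *\<^sub>R e)"
  proof (rule lipschitz_onI)
    show "0 \<le> L" unfolding L_def
      using c by (intro mult_nonneg_nonneg sum_nonneg) (auto simp: lacunary_coeff_nonneg)
    fix t s
    have "\<bar>P m t - P m s\<bar> \<le> (\<Sum>k<m. lacunary_coeff k * (4 ^ k * c) * \<bar>t - s\<bar>)"
      unfolding P_def sum_subtractf[symmetric]
    proof (intro order_trans[OF sum_abs] sum_mono)
      fix k
      have "\<bar>h (4 ^ k * (c * t)) - h (4 ^ k * (c * s))\<bar> \<le> 4 ^ k * c * \<bar>t - s\<bar>"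
        using h(2)[of "4 ^ k * (c * t)" "4 ^ k * (c * s)"] c
        by (simp add: abs_mult flip: right_diff_distrib)
      from mult_left_mono[OF this lacunary_coeff_nonneg[of k]]
      show "\<bar>lacunary_coeff k * h (4 ^ k * (c * t)) - lacunary_coeff k * h (4 ^ k * (c * s))\<bar> \<le>
          lacunary_coeff k * (4 ^ k * c) * \<bar>t - s\<bar>"
        by (simp add: abs_mult lacunary_coeff_nonneg mult.assoc flip: right_diff_distrib)
    qed
    then have "\<bar>P m t - P m s\<bar> \<le> (\<Sum>k<m. lacunary_coeff k * (4 ^ k * c)) * \<bar>t - s\<bar>"
      by (simp only: sum_distrib_right)
    from mult_right_mono[OF this norm_ge_zero[of e]]
    show "dist (P m t *\<^sub>R e) (P m s *\<^sub>R e) \<le> L * dist t s"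
      by (simp add: dist_norm L_def mult_ac flip: scaleR_diff_left)
  qed
  moreover have "(norm ((lacunary h (c * t) *\<^sub>R e - P m t *\<^sub>R e) -
      (lacunary h (c * s) *\<^sub>R e - P m s *\<^sub>R e)))\<^sup>2 \<le> d * (t - s)" if "s \<le> t" for s t
  proof -
    have "\<bar>(lacunary h (c * t) - P m t) - (lacunary h (c * s) - P m s)\<bar>\<^sup>2 \<le>
        (6 / sqrt (real (Suc m)) * sqrt (c * \<bar>t - s\<bar>))\<^sup>2"
      by (intro power_mono tail) simp
    also have "\<dots> = 36 * c * inverse (real (Suc m)) * (t - s)"
    proof -
      have "(sqrt (c * \<bar>t - s\<bar>))\<^sup>2 = c * (t - s)" using c that by simp
      then show ?thesis
        unfolding power_mult_distrib by (simp add: power_inverse divide_inverse)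
    qed
    finally have "(norm e)\<^sup>2 * ((lacunary h (c * t) - P m t) - (lacunary h (c * s) - P m s))\<^sup>2 \<le>
        (norm e)\<^sup>2 * (36 * c * inverse (real (Suc m)) * (t - s))"
      by (intro mult_left_mono) auto
    also have "\<dots> = Q * inverse (real (Suc m)) * (t - s)" by (simp add: Q_def)
    also have "\<dots> \<le> d * (t - s)"
      using m that by (intro mult_right_mono) auto
    finally show ?thesis
      by (simp add: power_mult_distrib mult.commute flip: scaleR_diff_left)
  qed
  ultimately show "\<exists>L \<eta>. L-lipschitz_on {0..T} \<eta> \<and> (\<forall>t. \<exists>c. \<eta> t = c *\<^sub>R e) \<and>
      (\<forall>s\<in>{0..T}. \<forall>t\<in>{0..T}. s \<le> t \<longrightarrow>
        (norm ((lacunary h (c * t) *\<^sub>R e - \<eta> t) - (lacunary h (c * s) *\<^sub>R e - \<eta> s)))\<^sup>2 \<le> d * (t - s))"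
    by (intro exI[of _ L] exI[of _ "\<lambda>t. P m t *\<^sub>R e"]) auto
qed

section \<open>The discrete area of the lacunary curve\<close>

lemma sum_root_of_unity_powers:
  fixes u :: complex
  assumes "u ^ n = 1" "u \<noteq> 1"
  shows "(\<Sum>j<n. u ^ j) = 0"
  using geometric_sum[OF assms(2), of n] assms by simp

text \<open>The product is \<open>cis\<close> at 2 pi (b - a) / n, which equals 1 only if n divides
  b - a; but |b - a| lies strictly between 0 and n.\<close>

lemma cis_power_neq_1:
  fixes a b n :: nat
  assumes "a < n" "b < n" "a \<noteq> b"
  shows "cnj (cis (2 * pi / n)) ^ a * cis (2 * pi / n) ^ b \<noteq> 1"
proof
  assume eq: "cnj (cis (2 * pi / n)) ^ a * cis (2 * pi / n) ^ b = 1"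
  have "cnj (cis (2 * pi / n)) ^ a * cis (2 * pi / n) ^ b = cis ((real b - real a) * (2 * pi / n))"
    by (simp add: cis_cnj Complex.DeMoivre cis_mult diff_divide_distrib algebra_simps)
  with eq have "cos ((real b - real a) * (2 * pi / n)) = 1"
    by (simp add: complex_eq_iff)
  then obtain i :: int where "(real b - real a) * (2 * pi / n) = i * 2 * pi"
    unfolding cos_one_2pi_int by auto
  then have "(2 * pi) * ((real b - real a) / n) = (2 * pi) * i"
    by (simp only: times_divide_eq_right mult_ac)
  then have "(real b - real a) / n = i"
    by (subst (asm) mult_left_cancel) auto
  then have "real b - real a = i * n"
    using assms by (simp add: field_simps)
  then have "real_of_int (int b - int a) = real_of_int (i * int n)" by simp
  then have *: "int b - int a = i * int n" by (simp only: of_int_eq_iff)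
  have "i = 0"
  proof (rule ccontr)
    assume "i \<noteq> 0"
    then have "1 \<le> \<bar>i\<bar>" by linarith
    then have "int n \<le> \<bar>i * int n\<bar>" by (simp add: abs_mult mult_le_cancel_right1)
    with * assms show False by linarith
  qed
  with * assms show False by simp
qed

text \<open>For z = x + i y the summand is the cross product x(j) y(j+1) - y(j) x(j+1), so the left
  side is twice the signed area of a polygon. Frequencies distinct modulo n give orthogonal
  characters, so only the diagonal terms of the expanded product survive.\<close>

lemma sum_Im_trig_polynomial:
  fixes c :: "nat \<Rightarrow> real" and f :: "nat \<Rightarrow> nat" and n :: nat
  assumes "finite I" "inj_on f I" "\<And>k. k \<in> I \<Longrightarrow> f k < n"
  defines "w \<equiv> cis (2 * pi / n)"
  defines "z \<equiv> \<lambda>j. \<Sum>k\<in>I. of_real (c k) * w ^ (f k * j)"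
  shows "(\<Sum>j<n. Im (cnj (z j) * z (Suc j))) = n * (\<Sum>k\<in>I. (c k)\<^sup>2 * sin (2 * pi * f k / n))"
proof (cases "n = 0")
  case False
  have w_n: "w ^ n = 1"
    using False by (simp add: w_def Complex.DeMoivre)
  define u where "u k l = cnj w ^ f k * w ^ f l" for k l
  have orth: "(\<Sum>j<n. u k l ^ j) = (if k = l then of_nat n else 0)" if kl: "k \<in> I" "l \<in> I" for k l
  proof (cases "k = l")
    case True
    have "cnj w * w = 1" by (simp add: w_def cis_cnj cis_mult)
    then have "u k l = 1" by (simp add: u_def True flip: power_mult_distrib)
    then show ?thesis using True by simp
  next
    case False
    have "u k l ^ n = cnj (w ^ n) ^ f k * (w ^ n) ^ f l"
      unfolding u_def by (simp add: power_mult_distrib mult.commute flip: power_mult)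
    then have "u k l ^ n = 1" by (simp add: w_n)
    moreover have "u k l \<noteq> 1"
      unfolding u_def w_def using False assms(2) kl
      by (intro cis_power_neq_1 assms(3)) (auto dest: inj_onD)
    ultimately show ?thesis using sum_root_of_unity_powers False by simp
  qed
  have "cnj (z j) * z (Suc j) =
      (\<Sum>k\<in>I. \<Sum>l\<in>I. of_real (c k) * of_real (c l) * w ^ f l * u k l ^ j)" for j
    unfolding z_def cnj_sum sum_product
    by (intro sum.cong refl) (simp add: u_def power_mult_distrib mult_ac power_add flip: power_mult)
  then have "(\<Sum>j<n. cnj (z j) * z (Suc j)) =
      (\<Sum>j<n. \<Sum>k\<in>I. \<Sum>l\<in>I. of_real (c k) * of_real (c l) * w ^ f l * u k l ^ j)"
    by simp
  also have "\<dots> = (\<Sum>k\<in>I. \<Sum>l\<in>I. \<Sum>j<n. of_real (c k) * of_real (c l) * w ^ f l * u k l ^ j)"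
    unfolding sum.swap[of _ I "{..<n}"] by (rule refl)
  also have "\<dots> = (\<Sum>k\<in>I. \<Sum>l\<in>I. if k = l then of_real (c k) * of_real (c l) * w ^ f l * of_nat n else 0)"
    by (intro sum.cong refl) (simp add: orth flip: sum_distrib_left)
  also have "\<dots> = (\<Sum>k\<in>I. of_real (c k) * of_real (c k) * w ^ f k * of_nat n)"
    using assms(1) by (simp add: sum.delta')
  also have "Im \<dots> = (\<Sum>k\<in>I. n * ((c k)\<^sup>2 * sin (2 * pi * f k / n)))"
    by (simp add: w_def Complex.DeMoivre power2_eq_square mult_ac)
  finally show ?thesis by (simp add: sum_distrib_left)
qed simp

lemma abs_sin_diff_le: "\<bar>sin x - sin y\<bar> \<le> \<bar>x - y\<bar>" for x y :: real
proof -
  have "\<bar>sin ((x - y) / 2)\<bar> * \<bar>cos ((x + y) / 2)\<bar> \<le> \<bar>(x - y) / 2\<bar> * 1"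
    by (intro mult_mono abs_sin_x_le_abs_x) auto
  then show ?thesis by (simp add: sin_diff_sin abs_mult)
qed

lemma abs_cos_diff_le: "\<bar>cos x - cos y\<bar> \<le> \<bar>x - y\<bar>" for x y :: real
  using abs_sin_diff_le[of "pi / 2 - x" "pi / 2 - y"] by (simp add: cos_sin_eq abs_minus_commute)

text \<open>The left side is twice the area of the regular polygon with \<open>4 ^ Suc i\<close>
  vertices in the unit circle. The square gives exactly 4, and refinement does not decrease it:
  doubling the angle twice yields sin (4 x) \<le> 4 sin x.\<close>

lemma sin_2pi_4_power_ge: "4 ^ Suc i * sin (2 * pi / 4 ^ Suc i) \<ge> 4"
proof (induction i)
  case (Suc i)
  define x where "x = 2 * pi / 4 ^ Suc (Suc i)"
  have x: "0 \<le> x" "2 * x \<le> pi / 2"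
  proof -
    have "(4::real) ^ 2 \<le> 4 ^ Suc (Suc i)" by (rule power_increasing) auto
    then have "x \<le> 2 * pi / 4 ^ 2"
      unfolding x_def by (rule divide_left_mono) auto
    then have "x * 8 \<le> pi" by simp
    moreover show "0 \<le> x" by (simp add: x_def)
    ultimately show "2 * x \<le> pi / 2" by linarith
  qed
  have double: "sin (2 * y) \<le> 2 * sin y" if "0 \<le> y" "y \<le> pi" for y
    unfolding sin_double using sin_ge_zero[OF that] by (simp add: mult_left_le)
  have "sin (4 * x) \<le> 2 * sin (2 * x)"
    using double[of "2 * x"] x by simp
  also have "\<dots> \<le> 2 * (2 * sin x)"
    using double[of x] x by simp
  finally have "4 ^ Suc i * sin (4 * x) \<le> 4 ^ Suc i * (4 * sin x)"
    by (intro mult_left_mono) auto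
  moreover have eq: "2 * pi / 4 ^ Suc i = 4 * x"
    by (simp add: x_def)
  ultimately have "4 \<le> 4 ^ Suc i * (4 * sin x)"
    using Suc.IH unfolding eq by linarith
  also have "\<dots> = 4 ^ Suc (Suc i) * sin x" by simp
  finally show ?case by (simp only: x_def)
qed simp

text \<open>At a grid point the mode k + M is evaluated at an integer multiple of 2 pi, so aliasing
  turns the infinite tail into a constant.\<close>

lemma lacunary_grid:
  fixes M j :: nat
  assumes periodic: "\<And>k::nat. h (2 * pi * real k) = h 0"
  shows "lacunary h (2 * pi * real j / 4 ^ M) =
    (\<Sum>k<M. lacunary_coeff k * h (2 * pi * real (4 ^ k * j) / 4 ^ M)) + suminf (\<lambda>k. lacunary_coeff (k + M)) * h 0"
proof -
  define u where "u k = lacunary_coeff k * h (4 ^ k * (2 * pi * real j / 4 ^ M))" for k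
  have tail: "u (k + M) = lacunary_coeff (k + M) * h 0" for k
  proof -
    have "4 ^ (k + M) * (2 * pi * real j / 4 ^ M) = 2 * pi * real (4 ^ k * j)"
      by (simp add: power_add)
    then show ?thesis unfolding u_def by (simp only: periodic)
  qed
  have sc: "summable (\<lambda>k. lacunary_coeff (k + M))"
    using summable_lacunary_coeff by (simp add: summable_iff_shift)
  have "summable (\<lambda>k. u (k + M))"
    unfolding tail by (rule summable_mult2[OF sc])
  then have "summable u" by (simp add: summable_iff_shift)
  then have "suminf u = (\<Sum>k<M. u k) + suminf (\<lambda>k. u (k + M))"
    using suminf_minus_initial_segment[of u M] by simp
  also have "suminf (\<lambda>k. u (k + M)) = suminf (\<lambda>k. lacunary_coeff (k + M)) * h 0"
    unfolding tail by (rule suminf_mult2[OF sc, symmetric])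
  finally show ?thesis
    by (simp add: lacunary_def u_def mult_ac)
qed

text \<open>Mode k runs 4^k times round a circle of radius c_k, sampled as a regular polygon with
  4^(M - k) vertices. Each turn contributes at least 4 c_k^2, with equality for the square at k = M
  - 1; orthogonality lets the modes be added separately.\<close>

lemma lacunary_discrete_area_ge:
  fixes M :: nat
  defines "x \<equiv> \<lambda>j. lacunary cos (2 * pi * real j / 4 ^ M)"
    and "y \<equiv> \<lambda>j. lacunary sin (2 * pi * real j / 4 ^ M)"
  shows "(\<Sum>j<4 ^ M. x j * y (Suc j) - y j * x (Suc j)) \<ge> 4 * (\<Sum>k<M. 1 / real (Suc k))"
proof -
  let ?n = "4 ^ M :: nat"
  define \<beta> where "\<beta> = suminf (\<lambda>k. lacunary_coeff (k + M))"
  text \<open>On the grid, the modes of index at least \<open>M\<close> are constant; they form the mode of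
    frequency 0, which is given the index \<open>M\<close>.\<close>
  define c where "c k = (if k < M then lacunary_coeff k else \<beta>)" for k
  define f where "f k = (if k < M then 4 ^ k else 0 :: nat)" for k
  define z where "z j = (\<Sum>k\<in>{..M}. of_real (c k) * cis (2 * pi / ?n) ^ (f k * j))" for j
  have "inj_on f {..M}"
    by (auto simp: inj_on_def f_def split: if_splits)
  moreover have "f k < ?n" for k
    by (auto simp: f_def)
  ultimately have area: "(\<Sum>j<?n. Im (cnj (z j) * z (Suc j))) =
      ?n * (\<Sum>k\<in>{..M}. (c k)\<^sup>2 * sin (2 * pi * f k / ?n))"
    unfolding z_def by (intro sum_Im_trig_polynomial) auto
  have sum_M: "(\<Sum>k\<in>{..M}. g k) = (\<Sum>k<M. g k) + g M" for g :: "nat \<Rightarrow> 'a::comm_monoid_add"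
    using sum.lessThan_Suc[of g M] by (simp only: lessThan_Suc_atMost)
  have z: "z j = (\<Sum>k<M. of_real (lacunary_coeff k) * cis (2 * pi * real (4 ^ k * j) / 4 ^ M)) + of_real \<beta>" for j
    unfolding z_def sum_M by (simp add: c_def f_def Complex.DeMoivre mult_ac)
  have "Re (z j) = x j" "Im (z j) = y j" for j
  proof -
    have cos: "cos (2 * pi * real k) = cos 0" and sin: "sin (2 * pi * real k) = sin 0" for k
      using cos_2npi[of k] sin_2npi[of k] by (simp_all add: mult_ac)
    show "Re (z j) = x j" "Im (z j) = y j"
      unfolding z x_def y_def lacunary_grid[of cos, OF cos] lacunary_grid[of sin, OF sin]
      by (simp_all add: \<beta>_def)
  qed
  then have "(\<Sum>j<?n. x j * y (Suc j) - y j * x (Suc j)) = (\<Sum>j<?n. Im (cnj (z j) * z (Suc j)))"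
    by (simp add: algebra_simps)
  \<comment> \<open>The constant mode has frequency 0, where the sine vanishes, so \<beta> drops
    out.\<close>
  also have "\<dots> = (\<Sum>k<M. ?n * ((lacunary_coeff k)\<^sup>2 * sin (2 * pi * 4 ^ k / ?n)))"
    unfolding area sum_M by (simp add: c_def f_def sum_distrib_left)
  also have "\<dots> \<ge> (\<Sum>k<M. 4 * (1 / real (Suc k)))"
  proof (rule sum_mono)
    fix k assume "k \<in> {..<M}"
    then obtain i where M: "M = k + Suc i" using less_imp_Suc_add by auto
    have coeff: "(lacunary_coeff k)\<^sup>2 * 4 ^ k = 1 / real (Suc k)"
    proof -
      have "((1 / 2 :: real) ^ k)\<^sup>2 = (1 / 4) ^ k"
        by (simp add: power2_eq_square flip: power_mult_distrib)
      then have "(lacunary_coeff k)\<^sup>2 = (1 / 4) ^ k / real (Suc k)"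
        unfolding lacunary_coeff_def power_divide[of _ "sqrt _"] by simp
      then have "(lacunary_coeff k)\<^sup>2 * 4 ^ k = (1 / 4) ^ k / real (Suc k) * 4 ^ k"
        by simp
      also have "(1 / 4 :: real) ^ k / real (Suc k) * 4 ^ k = 1 / real (Suc k)"
        by (simp add: power_one_over)
      finally show ?thesis .
    qed
    \<comment> \<open>Since 4^M = 4^k 4^(i+1), the factor 4^k normalises the squared coefficient to
      1 / (k + 1), and the rest is the polygon bound.\<close>
    have "2 * pi * 4 ^ k / 4 ^ M = 2 * pi / 4 ^ Suc i"
      by (simp add: M power_add)
    then have "?n * ((lacunary_coeff k)\<^sup>2 * sin (2 * pi * 4 ^ k / ?n)) =
        (lacunary_coeff k)\<^sup>2 * 4 ^ k * (4 ^ Suc i * sin (2 * pi / 4 ^ Suc i))"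
      by (simp add: M power_add)
    also have "\<dots> = 1 / real (Suc k) * (4 ^ Suc i * sin (2 * pi / 4 ^ Suc i))"
      by (simp only: coeff)
    also have "\<dots> \<ge> 1 / real (Suc k) * 4"
      by (intro mult_left_mono sin_2pi_4_power_ge) simp
    finally show "4 * (1 / real (Suc k)) \<le> ?n * ((lacunary_coeff k)\<^sup>2 * sin (2 * pi * 4 ^ k / ?n))"
      by simp
  qed
  finally show ?thesis by (simp add: sum_distrib_left)
qed

section \<open>Linearity\<close>

lemma C_1var_linear_combination:
  assumes "\<gamma> \<in> C_1var T" "\<eta> \<in> C_1var T"
  shows "(\<lambda>t. a *\<^sub>R \<gamma> t + b *\<^sub>R \<eta> t) \<in> C_1var T"
proof -
  obtain K L where K: "K \<ge> 0" "\<And>n \<tau>. is_partition 0 T n \<tau> \<Longrightarrow> (\<Sum>j<n. norm (\<gamma> (\<tau> (Suc j)) - \<gamma> (\<tau> j))) \<le> K"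
    and L: "L \<ge> 0" "\<And>n \<tau>. is_partition 0 T n \<tau> \<Longrightarrow> (\<Sum>j<n. norm (\<eta> (\<tau> (Suc j)) - \<eta> (\<tau> j))) \<le> L"
    using assms unfolding C_1var_iff by blast
  have le: "(\<Sum>j<n. norm ((a *\<^sub>R \<gamma> (\<tau> (Suc j)) + b *\<^sub>R \<eta> (\<tau> (Suc j))) -
      (a *\<^sub>R \<gamma> (\<tau> j) + b *\<^sub>R \<eta> (\<tau> j)))) \<le> \<bar>a\<bar> * K + \<bar>b\<bar> * L" if "is_partition 0 T n \<tau>" for n \<tau>
  proof -
    have "norm ((a *\<^sub>R \<gamma> t + b *\<^sub>R \<eta> t) - (a *\<^sub>R \<gamma> s + b *\<^sub>R \<eta> s)) \<le>
        \<bar>a\<bar> * norm (\<gamma> t - \<gamma> s) + \<bar>b\<bar> * norm (\<eta> t - \<eta> s)" for s t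
    proof -
      have "(a *\<^sub>R \<gamma> t + b *\<^sub>R \<eta> t) - (a *\<^sub>R \<gamma> s + b *\<^sub>R \<eta> s) = a *\<^sub>R (\<gamma> t - \<gamma> s) + b *\<^sub>R (\<eta> t - \<eta> s)"
        by (simp add: algebra_simps)
      then show ?thesis
        using norm_triangle_ineq[of "a *\<^sub>R (\<gamma> t - \<gamma> s)" "b *\<^sub>R (\<eta> t - \<eta> s)"] by simp
    qed
    then have "(\<Sum>j<n. norm ((a *\<^sub>R \<gamma> (\<tau> (Suc j)) + b *\<^sub>R \<eta> (\<tau> (Suc j))) -
        (a *\<^sub>R \<gamma> (\<tau> j) + b *\<^sub>R \<eta> (\<tau> j)))) \<le>
        \<bar>a\<bar> * (\<Sum>j<n. norm (\<gamma> (\<tau> (Suc j)) - \<gamma> (\<tau> j))) +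
        \<bar>b\<bar> * (\<Sum>j<n. norm (\<eta> (\<tau> (Suc j)) - \<eta> (\<tau> j)))"
      unfolding sum_distrib_left sum.distrib[symmetric] by (rule sum_mono)
    also have "\<dots> \<le> \<bar>a\<bar> * K + \<bar>b\<bar> * L"
      by (intro add_mono mult_left_mono K(2) L(2) that) auto
    finally show ?thesis .
  qed
  have "continuous_on {0..T} (\<lambda>t. a *\<^sub>R \<gamma> t + b *\<^sub>R \<eta> t)"
    using assms by (intro continuous_intros) (auto simp: C_1var_def)
  then show ?thesis
    unfolding C_1var_iff using K(1) L(1) le
    by (intro conjI exI[of _ "\<bar>a\<bar> * K + \<bar>b\<bar> * L"]) auto
qed

text \<open>In the tolerances, 4 absorbs the factor 2 of \<open>norm_add_square_le\<close> and the
  splitting of d into two halves; adding 1 to the squared coefficient covers a zero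
  coefficient.\<close>

lemma sum_squares_linear_combination_le:
  fixes f g :: "nat \<Rightarrow> 'a::real_normed_vector"
  assumes f: "(\<Sum>j<n. (norm (f j))\<^sup>2) \<le> d / (4 * (a\<^sup>2 + 1))" and g: "(\<Sum>j<n. (norm (g j))\<^sup>2) \<le> d / (4 * (b\<^sup>2 + 1))"
  shows "(\<Sum>j<n. (norm (a *\<^sub>R f j + b *\<^sub>R g j))\<^sup>2) \<le> d"
proof -
  have part: "c\<^sup>2 * S \<le> d / 4" if "S \<le> d / (4 * (c\<^sup>2 + 1))" "0 \<le> S" for c S :: real
  proof -
    have pos: "c\<^sup>2 + 1 > 0" by (simp add: add_nonneg_pos)
    have "c\<^sup>2 * S \<le> (c\<^sup>2 + 1) * S" using that(2) by (simp add: distrib_right)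
    also have "\<dots> \<le> (c\<^sup>2 + 1) * (d / (4 * (c\<^sup>2 + 1)))"
      using that(1) pos by (intro mult_left_mono) auto
    also have "\<dots> = d / 4"
    proof -
      have "p * (d / (4 * p)) = d / 4" if "p > 0" for p using that by simp
      then show ?thesis using pos .
    qed
    finally show ?thesis .
  qed
  have "(\<Sum>j<n. (norm (a *\<^sub>R f j + b *\<^sub>R g j))\<^sup>2) \<le>
      (\<Sum>j<n. 2 * (norm (a *\<^sub>R f j))\<^sup>2 + 2 * (norm (b *\<^sub>R g j))\<^sup>2)"
    by (intro sum_mono norm_add_square_le)
  also have "\<dots> = 2 * (a\<^sup>2 * (\<Sum>j<n. (norm (f j))\<^sup>2)) + 2 * (b\<^sup>2 * (\<Sum>j<n. (norm (g j))\<^sup>2))"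
    by (simp add: sum.distrib power_mult_distrib sum_distrib_left)
  also have "\<dots> \<le> 2 * (d / 4) + 2 * (d / 4)"
    by (intro add_mono mult_left_mono part f g sum_nonneg) auto
  finally show ?thesis by simp
qed

lemma vanishing_2_variation_linear_combination:
  assumes "vanishing_2_variation T \<gamma>" "vanishing_2_variation T \<eta>"
  shows "vanishing_2_variation T (\<lambda>t. a *\<^sub>R \<gamma> t + b *\<^sub>R \<eta> t)"
  unfolding vanishing_2_variation_iff
proof (intro allI impI)
  fix d :: real assume "d > 0"
  then have pos: "d / (4 * (c\<^sup>2 + 1)) > 0" for c
    by (intro divide_pos_pos mult_pos_pos add_nonneg_pos) auto
  obtain d1 where d1: "d1 > 0" "\<And>n \<tau>. is_partition 0 T n \<tau> \<Longrightarrow> (\<forall>j<n. \<tau> (Suc j) - \<tau> j \<le> d1) \<Longrightarrow>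
      (\<Sum>j<n. (norm (\<gamma> (\<tau> (Suc j)) - \<gamma> (\<tau> j)))\<^sup>2) \<le> d / (4 * (a\<^sup>2 + 1))"
    using assms(1) pos[of a] unfolding vanishing_2_variation_iff by meson
  obtain d2 where d2: "d2 > 0" "\<And>n \<tau>. is_partition 0 T n \<tau> \<Longrightarrow> (\<forall>j<n. \<tau> (Suc j) - \<tau> j \<le> d2) \<Longrightarrow>
      (\<Sum>j<n. (norm (\<eta> (\<tau> (Suc j)) - \<eta> (\<tau> j)))\<^sup>2) \<le> d / (4 * (b\<^sup>2 + 1))"
    using assms(2) pos[of b] unfolding vanishing_2_variation_iff by meson
  show "\<exists>\<delta>>0. \<forall>n \<tau>. is_partition 0 T n \<tau> \<longrightarrow> (\<forall>j<n. \<tau> (Suc j) - \<tau> j \<le> \<delta>) \<longrightarrow>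
      (\<Sum>j<n. (norm ((a *\<^sub>R \<gamma> (\<tau> (Suc j)) + b *\<^sub>R \<eta> (\<tau> (Suc j))) -
        (a *\<^sub>R \<gamma> (\<tau> j) + b *\<^sub>R \<eta> (\<tau> j))))\<^sup>2) \<le> d"
  proof (intro exI[of _ "min d1 d2"] conjI allI impI)
    fix n \<tau> assume \<tau>: "is_partition 0 T n \<tau>" "\<forall>j<n. \<tau> (Suc j) - \<tau> j \<le> min d1 d2"
    have "(\<Sum>j<n. (norm (a *\<^sub>R (\<gamma> (\<tau> (Suc j)) - \<gamma> (\<tau> j)) + b *\<^sub>R (\<eta> (\<tau> (Suc j)) - \<eta> (\<tau> j))))\<^sup>2) \<le> d"
      using \<tau> by (intro sum_squares_linear_combination_le d1(2) d2(2)) auto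
    then show "(\<Sum>j<n. (norm ((a *\<^sub>R \<gamma> (\<tau> (Suc j)) + b *\<^sub>R \<eta> (\<tau> (Suc j))) -
        (a *\<^sub>R \<gamma> (\<tau> j) + b *\<^sub>R \<eta> (\<tau> j))))\<^sup>2) \<le> d"
      by (simp add: algebra_simps)
  qed (use d1(1) d2(1) in simp)
qed

text \<open>The given enhancements are dropped: the whole space is a line, so combinations of
  approximants have zero area and the zero enhancement works again.\<close>

lemma G2_linear_combination:
  fixes \<iota> :: "('v::banach, 'v) tensor \<Rightarrow> 'w::banach"
  assumes B: "bounded_bilinear (bracket \<iota>)" and e: "\<And>v :: 'v. \<exists>c. v = c *\<^sub>R e"
    and \<gamma>: "\<gamma> \<in> G2 \<iota> T" and \<eta>: "\<eta> \<in> G2 \<iota> T"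
  shows "(\<lambda>t. a *\<^sub>R \<gamma> t + b *\<^sub>R \<eta> t) \<in> G2 \<iota> T"
proof -
  have cont: "continuous_on {0..T} (\<lambda>t. a *\<^sub>R \<gamma> t + b *\<^sub>R \<eta> t)"
    using \<gamma> \<eta> by (intro continuous_intros) (auto simp: G2_def)
  have approx: "\<exists>\<gamma>\<^sub>n. (\<forall>m. \<gamma>\<^sub>n m \<in> C_1var T) \<and> (\<forall>d>0. \<forall>\<^sub>F m in sequentially. \<forall>n \<tau>. is_partition 0 T n \<tau> \<longrightarrow>
      (\<Sum>j<n. (norm ((\<zeta> (\<tau> (Suc j)) - \<gamma>\<^sub>n m (\<tau> (Suc j))) - (\<zeta> (\<tau> j) - \<gamma>\<^sub>n m (\<tau> j))))\<^sup>2) \<le> d)"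
    if "\<zeta> \<in> G2 \<iota> T" for \<zeta>
    using that unfolding G2_def geometric_2_rough_path_iff by blast
  obtain \<gamma>\<^sub>n where \<gamma>n: "\<And>m. \<gamma>\<^sub>n m \<in> C_1var T"
    "\<And>d. d > 0 \<Longrightarrow> \<forall>\<^sub>F m in sequentially. \<forall>n \<tau>. is_partition 0 T n \<tau> \<longrightarrow>
      (\<Sum>j<n. (norm ((\<gamma> (\<tau> (Suc j)) - \<gamma>\<^sub>n m (\<tau> (Suc j))) - (\<gamma> (\<tau> j) - \<gamma>\<^sub>n m (\<tau> j))))\<^sup>2) \<le> d"
    using approx[OF \<gamma>] by blast
  obtain \<eta>\<^sub>n where \<eta>n: "\<And>m. \<eta>\<^sub>n m \<in> C_1var T"
    "\<And>d. d > 0 \<Longrightarrow> \<forall>\<^sub>F m in sequentially. \<forall>n \<tau>. is_partition 0 T n \<tau> \<longrightarrow>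
      (\<Sum>j<n. (norm ((\<eta> (\<tau> (Suc j)) - \<eta>\<^sub>n m (\<tau> (Suc j))) - (\<eta> (\<tau> j) - \<eta>\<^sub>n m (\<tau> j))))\<^sup>2) \<le> d"
    using approx[OF \<eta>] by blast
  have "geometric_2_rough_path \<iota> T (\<lambda>t. a *\<^sub>R \<gamma> t + b *\<^sub>R \<eta> t) (\<lambda>_. 0)"
  proof (rule geometric_2_rough_path_multiplesI[OF B cont, where
        \<gamma>\<^sub>n = "\<lambda>m t. a *\<^sub>R \<gamma>\<^sub>n m t + b *\<^sub>R \<eta>\<^sub>n m t" and e = e])
    show "(\<lambda>t. a *\<^sub>R \<gamma>\<^sub>n m t + b *\<^sub>R \<eta>\<^sub>n m t) \<in> C_1var T" for m
      by (rule C_1var_linear_combination[OF \<gamma>n(1) \<eta>n(1)])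
    show "\<exists>c. a *\<^sub>R \<gamma>\<^sub>n m t + b *\<^sub>R \<eta>\<^sub>n m t = c *\<^sub>R e" for m t
      by (rule e)
    fix d :: real assume "d > 0"
    then have pos: "d / (4 * (c\<^sup>2 + 1)) > 0" for c
      by (intro divide_pos_pos mult_pos_pos add_nonneg_pos) auto
    show "\<forall>\<^sub>F m in sequentially. \<forall>n \<tau>. is_partition 0 T n \<tau> \<longrightarrow>
      (\<Sum>j<n. (norm ((a *\<^sub>R \<gamma> (\<tau> (Suc j)) + b *\<^sub>R \<eta> (\<tau> (Suc j)) -
          (a *\<^sub>R \<gamma>\<^sub>n m (\<tau> (Suc j)) + b *\<^sub>R \<eta>\<^sub>n m (\<tau> (Suc j)))) -
        (a *\<^sub>R \<gamma> (\<tau> j) + b *\<^sub>R \<eta> (\<tau> j) - (a *\<^sub>R \<gamma>\<^sub>n m (\<tau> j) + b *\<^sub>R \<eta>\<^sub>n m (\<tau> j)))))\<^sup>2) \<le> d"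
      using \<gamma>n(2)[OF pos[of a]] \<eta>n(2)[OF pos[of b]]
    proof eventually_elim
      case (elim m)
      show ?case
      proof (intro allI impI)
        fix n \<tau> assume \<tau>: "is_partition 0 T n \<tau>"
        let ?f = "\<lambda>j. (\<gamma> (\<tau> (Suc j)) - \<gamma>\<^sub>n m (\<tau> (Suc j))) - (\<gamma> (\<tau> j) - \<gamma>\<^sub>n m (\<tau> j))"
        let ?g = "\<lambda>j. (\<eta> (\<tau> (Suc j)) - \<eta>\<^sub>n m (\<tau> (Suc j))) - (\<eta> (\<tau> j) - \<eta>\<^sub>n m (\<tau> j))"
        have "(\<Sum>j<n. (norm (a *\<^sub>R ?f j + b *\<^sub>R ?g j))\<^sup>2) \<le> d"
          by (rule sum_squares_linear_combination_le) (use elim \<tau> in blast)+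
        then show "(\<Sum>j<n. (norm ((a *\<^sub>R \<gamma> (\<tau> (Suc j)) + b *\<^sub>R \<eta> (\<tau> (Suc j)) -
            (a *\<^sub>R \<gamma>\<^sub>n m (\<tau> (Suc j)) + b *\<^sub>R \<eta>\<^sub>n m (\<tau> (Suc j)))) -
          (a *\<^sub>R \<gamma> (\<tau> j) + b *\<^sub>R \<eta> (\<tau> j) - (a *\<^sub>R \<gamma>\<^sub>n m (\<tau> j) + b *\<^sub>R \<eta>\<^sub>n m (\<tau> j)))))\<^sup>2) \<le> d"
          by (simp add: algebra_simps)
      qed
    qed
  qed
  moreover have "vanishing_2_variation T (\<lambda>t. a *\<^sub>R \<gamma> t + b *\<^sub>R \<eta> t)"
    using \<gamma> \<eta> by (intro vanishing_2_variation_linear_combination) (auto simp: G2_def)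
  ultimately show ?thesis
    using cont by (auto simp: G2_def)
qed

lemma linear_space_G2_if_multiples:
  fixes \<iota> :: "('v::banach, 'v) tensor \<Rightarrow> 'w::banach"
  assumes B: "bounded_bilinear (bracket \<iota>)" and T: "T > 0" and e: "\<And>v :: 'v. \<exists>c. v = c *\<^sub>R e"
  shows "linear_space_of_paths (G2 \<iota> T)"
  unfolding linear_space_of_paths_def
proof (intro conjI ballI allI)
  have "0-lipschitz_on {0..T} (\<lambda>_. 0 :: 'v)"
    by (rule lipschitz_onI) auto
  then show "(\<lambda>_. 0) \<in> G2 \<iota> T"
    by (intro G2_multiplesI[OF B T, where e=e] exI[of _ 0] exI[of _ "\<lambda>_. 0"]) (auto intro: e)
  fix \<gamma> \<eta> c assume \<gamma>: "\<gamma> \<in> G2 \<iota> T"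
  show "(\<lambda>t. c *\<^sub>R \<gamma> t) \<in> G2 \<iota> T"
    using G2_linear_combination[OF B e \<gamma> \<gamma>, of c 0] by simp
  assume "\<eta> \<in> G2 \<iota> T"
  then show "(\<lambda>t. \<gamma> t + \<eta> t) \<in> G2 \<iota> T"
    using G2_linear_combination[OF B e \<gamma>, of \<eta> 1 1] by simp
qed

section \<open>Failure of linearity\<close>

lemma lacunary_curve_not_in_G2:
  fixes \<iota> :: "('v::banach, 'v) tensor \<Rightarrow> 'w::banach"
  assumes B: "bounded_bilinear (bracket \<iota>)" and T: "T > 0" and ab: "bracket \<iota> a b \<noteq> 0"
  shows "(\<lambda>t. lacunary cos (2 * pi / T * t) *\<^sub>R a + lacunary sin (2 * pi / T * t) *\<^sub>R b) \<notin> G2 \<iota> T"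
    (is "?\<gamma> \<notin> _")
proof
  assume "?\<gamma> \<in> G2 \<iota> T"
  then obtain C where C: "\<And>n. n > 0 \<Longrightarrow> norm (\<Sum>j<n. bracket \<iota> (?\<gamma> (T * real j / real n) - ?\<gamma> 0)
    (?\<gamma> (T * real (Suc j) / real n) - ?\<gamma> (T * real j / real n))) \<le> C"
    using G2_uniform_area_bounded[OF B T, of ?\<gamma>] by blast
  interpret bounded_bilinear "bracket \<iota>" by fact
  have anti: "bracket \<iota> b a = - bracket \<iota> a b" by (simp add: bracket_def)
  have "4 * (\<Sum>k<M. 1 / real (Suc k)) * norm (bracket \<iota> a b) \<le> C" for M
  proof -
    define x where "x j = lacunary cos (2 * pi * real j / 4 ^ M)" for j
    define y where "y j = lacunary sin (2 * pi * real j / 4 ^ M)" for j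
    define z where "z j = x j *\<^sub>R a + y j *\<^sub>R b" for j
    let ?n = "4 ^ M :: nat"
    \<comment> \<open>The time factor 2 pi / T makes [0, T] one period, so the uniform partition
      points become the aliasing grid.\<close>
    have z: "?\<gamma> (T * real j / real ?n) = z j" for j
      using T by (simp add: z_def x_def y_def mult.assoc)
    have z0: "?\<gamma> 0 = z 0" using z[of 0] by simp
    \<comment> \<open>Both points lie on the grid with M = 0, where every mode is constant. The
      polygon is therefore closed, and subtracting the base point z 0 does not change its discrete
      area.\<close>
    have "z ?n = z 0"
    proof -
      have cos: "cos (2 * pi * real k) = cos 0" and sin: "sin (2 * pi * real k) = sin 0" for k
        using cos_2npi[of k] sin_2npi[of k] by (simp_all add: mult_ac)
      show ?thesis
        using lacunary_grid[of cos 1 0, OF cos] lacunary_grid[of sin 1 0, OF sin]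
          lacunary_grid[of cos 0 0, OF cos] lacunary_grid[of sin 0 0, OF sin]
        by (simp add: z_def x_def y_def)
    qed
    then have "(\<Sum>j<?n. z (Suc j) - z j) = 0"
      using sum_lessThan_telescope[of z ?n] by simp
    then have closed: "(\<Sum>j<?n. bracket \<iota> (z 0) (z (Suc j) - z j)) = 0"
      by (simp add: zero_right flip: sum_right)
    \<comment> \<open>The base point drops out by \<open>closed\<close>, and z j in the increment
      drops out because its bracket with itself is 0.\<close>
    have "(\<Sum>j<?n. bracket \<iota> (z j - z 0) (z (Suc j) - z j)) = (\<Sum>j<?n. bracket \<iota> (z j) (z (Suc j)))"
      using closed by (simp add: diff_left sum_subtractf) (simp add: diff_right)
    also have "\<dots> = (\<Sum>j<?n. (x j * y (Suc j) - y j * x (Suc j)) *\<^sub>R bracket \<iota> a b)"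
      by (intro sum.cong refl)
        (simp add: z_def add_left add_right scaleR_left scaleR_right anti algebra_simps)
    finally have area_le: "norm ((\<Sum>j<?n. x j * y (Suc j) - y j * x (Suc j)) *\<^sub>R bracket \<iota> a b) \<le> C"
      using C[of ?n] unfolding z z0 by (simp add: scaleR_sum_left)
    have "4 * (\<Sum>k<M. 1 / real (Suc k)) \<le> \<bar>\<Sum>j<?n. x j * y (Suc j) - y j * x (Suc j)\<bar>"
      using lacunary_discrete_area_ge[of M] unfolding x_def y_def by linarith
    from mult_right_mono[OF this norm_ge_zero[of "bracket \<iota> a b"]]
    have "4 * (\<Sum>k<M. 1 / real (Suc k)) * norm (bracket \<iota> a b) \<le>
        norm ((\<Sum>j<?n. x j * y (Suc j) - y j * x (Suc j)) *\<^sub>R bracket \<iota> a b)"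
      by simp
    also have "\<dots> \<le> C" by (rule area_le)
    finally show ?thesis .
  qed
  \<comment> \<open>Bounded partial sums of nonnegative terms would make the harmonic series
    summable.\<close>
  then have "(\<Sum>k<M. 1 / real (Suc k)) \<le> C / (4 * norm (bracket \<iota> a b))" for M
    using ab by (simp add: field_simps)
  then have "summable (\<lambda>k. 1 / real (Suc k))"
    by (intro summableI_nonneg_bounded[of _ "C / (4 * norm (bracket \<iota> a b))"]) auto
  then have "summable (\<lambda>k. inverse (real (Suc k)))"
    by (simp add: inverse_eq_divide)
  then have "summable (\<lambda>k. inverse (real k))"
    using summable_Suc_iff[of "\<lambda>k. inverse (real k)"] by simp
  then show False
    using not_summable_harmonic[where 'a=real] by blast
qed

lemma not_linear_space_G2:
  fixes \<iota> :: "('v::banach, 'v) tensor \<Rightarrow> 'w::banach"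
  assumes B: "bounded_bilinear (bracket \<iota>)" and T: "T > 0" and ab: "bracket \<iota> a b \<noteq> 0"
  shows "\<not> linear_space_of_paths (G2 \<iota> T)"
proof
  assume "linear_space_of_paths (G2 \<iota> T)"
  then have add: "(\<lambda>t. \<gamma> t + \<eta> t) \<in> G2 \<iota> T" if "\<gamma> \<in> G2 \<iota> T" "\<eta> \<in> G2 \<iota> T" for \<gamma> \<eta>
    using that by (simp add: linear_space_of_paths_def)
  have "(\<lambda>t. lacunary cos (2 * pi / T * t) *\<^sub>R a) \<in> G2 \<iota> T"
    "(\<lambda>t. lacunary sin (2 * pi / T * t) *\<^sub>R b) \<in> G2 \<iota> T"
    by (rule lacunary_multiple_in_G2[OF B T]; use T abs_cos_diff_le abs_sin_diff_le in simp)+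
  from lacunary_curve_not_in_G2[OF B T ab] add[OF this] show False
    by (rule notE)
qed

theorem mainTheorem7:
  fixes T :: real
    and N :: "('v::banach, 'v) tensor \<Rightarrow> real"
    and \<iota> :: "('v, 'v) tensor \<Rightarrow> 'w::banach"
  assumes "T > 0"
    and "tensor_norm N"
    and "tensor_completion N \<iota>"
  shows "(dim (UNIV :: 'v set) = 1 \<longrightarrow> linear_space_of_paths (G2 \<iota> T)) \<and>
         (dim_ge_2 TYPE('v) \<longrightarrow> \<not> linear_space_of_paths (G2 \<iota> T))"
proof (intro conjI impI)
  have B: "bounded_bilinear (bracket \<iota>)"
    using bounded_bilinear_bracket assms(2,3) .
  show "linear_space_of_paths (G2 \<iota> T)" if dim: "dim (UNIV :: 'v set) = 1"
  proof -
    obtain e :: 'v where "\<And>v. \<exists>c. v = c *\<^sub>R e"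
      using dim_1_multiples[OF dim] by blast
    then show ?thesis by (rule linear_space_G2_if_multiples[OF B assms(1)])
  qed
  show "\<not> linear_space_of_paths (G2 \<iota> T)" if dim: "dim_ge_2 TYPE('v)"
  proof -
    obtain a b :: 'v where "a \<noteq> b" "independent {a, b}"
      using two_independent_vectors[OF dim] by blast
    then show ?thesis
      using not_linear_space_G2[OF B assms(1)] bracket_neq_0[OF assms(2,3)] by blast
  qed
qed

end
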